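(* Let $G$ be a bull-free graph that is either odd-hole-free or $P_5$-free. Then $G$ is perfectly weight divisible, and hence perfectly divisible.
   Context: All graphs are finite and simple. The bull is the graph on $5$ vertices consisting of a triangle with two disjoint pendant edges (i.e. vertices $a,b,c,d,e$ with edges $ab,bc,ca,ad,be$). $P_5$ is the path on $5$ vertices. For a graph $F$, a graph is $F$-free if no induced subgraph of it is isomorphic to $F$. A hole in a graph is an induced subgraph isomorphic to the cycle $C_k$ for some $k\ge 4$; it is odd if $k$ is odd. A graph is odd-hole-free if it contains no odd hole. $G[X]$ denotes the subgraph of $G$ induced by $X\subseteq V(G)$; $\omega$ denotes the clique number ($0$ for the graph with no vertices), and $\omega(B)$ for a vertex set $B$ means the clique number of the subgraph induced by $B$. A graph $G$ is perfect if $\chi(H)=\omega(H)$ for every induced subgraph $H$ of $G$, where $\chi$ is the chromatic number. A graph $G$ is perfectly divisible if for every induced subgraph $H$ of $G$ with at least one vertex, $V(H)$ can be partitioned into two sets $A,B$ such that $H[A]$ is perfect and $\omega(B)<\omega(H)$. A graph $G$ is perfectly weight divisible if for every non-negative integer weight function $w$ on $V(G)$ that is not identically zero, there is a partition of $V(G)$ into two sets $P,W$ such that $G[P]$ is perfect and the maximum weight of a clique in $G[W]$ is smaller than the maximum weight of a clique in $G$. The weight of a clique is the sum of the weights of its vertices; the empty set is a clique of weight $0$. Parts of a partition are allowed to be empty. *)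

theory Defs
  imports "HOL-Library.Ramsey"
begin

text \<open>
  A graph is a pair of a vertex set and a set of edges, an edge being an unordered pair
  \<open>{u, v}\<close>. The predicate \<^const>\<open>clique\<close> and the notation
  for the 2-element subsets of a set are those of \<^theory>\<open>HOL-Library.Ramsey\<close>.
\<close>

type_synonym 'a sgraph = "'a set \<times> 'a set set"

abbreviation verts :: "'a sgraph \<Rightarrow> 'a set" where
  "verts G \<equiv> fst G"

abbreviation edges :: "'a sgraph \<Rightarrow> 'a set set" where
  "edges G \<equiv> snd G"

definition finite_simple_graph :: "'a sgraph \<Rightarrow> bool" where
  "finite_simple_graph G \<longleftrightarrow> finite (verts G) \<and> edges G \<subseteq> [verts G]\<^bsup>2\<^esup>"

text \<open>Only meaningful for \<open>X \<subseteq> verts G\<close>; all uses below carry this guard.\<close>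

definition induced :: "'a sgraph \<Rightarrow> 'a set \<Rightarrow> 'a sgraph" where
  "induced G X = (X, {e \<in> edges G. e \<subseteq> X})"

definition isomorphic :: "'a sgraph \<Rightarrow> 'b sgraph \<Rightarrow> bool" where
  "isomorphic G H \<longleftrightarrow>
     (\<exists>f. bij_betw f (verts G) (verts H) \<and>
          (\<forall>u\<in>verts G. \<forall>v\<in>verts G. {u, v} \<in> edges G \<longleftrightarrow> {f u, f v} \<in> edges H))"

definition free_of :: "'b sgraph \<Rightarrow> 'a sgraph \<Rightarrow> bool" where
  "free_of F G \<longleftrightarrow> \<not> (\<exists>X \<subseteq> verts G. isomorphic (induced G X) F)"

text \<open>The bull with \<open>a, b, c, d, e\<close> encoded as \<open>0, 1, 2, 3, 4\<close>.\<close>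

definition bull :: "nat sgraph" where
  "bull = ({0, 1, 2, 3, 4}, {{0, 1}, {1, 2}, {2, 0}, {0, 3}, {1, 4}})"

definition path_graph :: "nat \<Rightarrow> nat sgraph" where
  "path_graph n = ({..<n}, {{i, Suc i} | i. Suc i < n})"

text \<open>This is the cycle \<open>C\<^sub>k\<close> for \<open>k \<ge> 3\<close>.\<close>

definition cycle_graph :: "nat \<Rightarrow> nat sgraph" where
  "cycle_graph k = ({..<k}, {{i, Suc i mod k} | i. i < k})"

definition hole :: "'a sgraph \<Rightarrow> nat \<Rightarrow> 'a set \<Rightarrow> bool" where
  "hole G k X \<longleftrightarrow> X \<subseteq> verts G \<and> k \<ge> 4 \<and> isomorphic (induced G X) (cycle_graph k)"

definition odd_hole_free :: "'a sgraph \<Rightarrow> bool" where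
  "odd_hole_free G \<longleftrightarrow> \<not> (\<exists>k X. odd k \<and> hole G k X)"

definition cliques :: "'a sgraph \<Rightarrow> 'a set set" where
  "cliques G = {K. K \<subseteq> verts G \<and> clique K (edges G)}"

definition clique_number :: "'a sgraph \<Rightarrow> nat" where
  "clique_number G = Max (card ` cliques G)"

definition proper_coloring :: "'a sgraph \<Rightarrow> nat \<Rightarrow> ('a \<Rightarrow> nat) \<Rightarrow> bool" where
  "proper_coloring G n c \<longleftrightarrow>
     c ` verts G \<subseteq> {..<n} \<and> (\<forall>u v. {u, v} \<in> edges G \<longrightarrow> c u \<noteq> c v)"

definition chromatic_number :: "'a sgraph \<Rightarrow> nat" where
  "chromatic_number G = (LEAST n. \<exists>c. proper_coloring G n c)"

definition perfect :: "'a sgraph \<Rightarrow> bool" where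
  "perfect G \<longleftrightarrow>
     (\<forall>X \<subseteq> verts G. chromatic_number (induced G X) = clique_number (induced G X))"

text \<open>A partition into two sets, either of which may be empty.\<close>

definition bipartition_of :: "'a set \<Rightarrow> 'a set \<Rightarrow> 'a set \<Rightarrow> bool" where
  "bipartition_of V A B \<longleftrightarrow> A \<union> B = V \<and> A \<inter> B = {}"

definition perfectly_divisible :: "'a sgraph \<Rightarrow> bool" where
  "perfectly_divisible G \<longleftrightarrow>
     (\<forall>X \<subseteq> verts G. X \<noteq> {} \<longrightarrow>
       (let H = induced G X in
         \<exists>A B. bipartition_of (verts H) A B \<and> perfect (induced H A) \<and>
           clique_number (induced H B) < clique_number H))"

definition max_clique_weight :: "('a \<Rightarrow> nat) \<Rightarrow> 'a sgraph \<Rightarrow> nat" where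
  "max_clique_weight w G = Max (sum w ` cliques G)"

text \<open>
  Weights range over functions on the whole type; the values outside \<open>verts G\<close> are irrelevant,
  and the weight function is required to be nonzero somewhere on \<open>verts G\<close>.
\<close>

definition perfectly_weight_divisible :: "'a sgraph \<Rightarrow> bool" where
  "perfectly_weight_divisible G \<longleftrightarrow>
     (\<forall>w :: 'a \<Rightarrow> nat. (\<exists>v \<in> verts G. w v \<noteq> 0) \<longrightarrow>
       (\<exists>P W. bipartition_of (verts G) P W \<and> perfect (induced G P) \<and>
         max_clique_weight w (induced G W) < max_clique_weight w G))"

end

theory Submission
  imports Defs Complex_Main
begin

text \<open>
  Vertices of weight zero can be deleted and homogeneous sets contracted, so assume that all
  weights are positive and \<open>G\<close> has no homogeneous set. For any vertex \<open>v\<close>, the neighborhood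
  \<open>N(v)\<close> loses weight against \<open>G\<close>, because \<open>v\<close> extends each of its cliques; it remains
  to see that the set \<open>P\<close> of the other vertices is perfect.

  The strong perfect graph theorem is avoided. Let \<open>F \<subseteq> P\<close> be minimal imperfect. It is
  connected, has no homogeneous set, and \<open>v\<close> is anticomplete to it. Since \<open>G\<close> is bull-free
  without homogeneous set, there are adjacent \<open>w\<close>, \<open>u\<close> with \<open>w\<close> anticomplete to \<open>F\<close> and
  \<open>u\<close> mixed on \<open>F\<close>; bull-freeness makes the components of \<open>S = N(u) \<inter> F\<close> homogeneous in
  \<open>F\<close>, so \<open>S\<close> is stable. If \<open>G\<close> is \<open>P\<^sub>5\<close>-free, the components of \<open>F - S\<close> are homogeneous
  too, so \<open>F\<close> is bipartite. If \<open>G\<close> has no odd hole, two vertices of \<open>S\<close> can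
  be given the same color in every subgraph \<open>F - z\<close> by a Kempe exchange, which a rank argument
  in the style of Gasparyan excludes; hence \<open>S = {s}\<close>, then \<open>N(s) \<inter> F\<close> is stable as well,
  by the same token has at most one element, and an optimal coloring of \<open>F - s\<close> extends to \<open>F\<close>.
\<close>

section \<open>Incidence systems\<close>

text \<open>Gaussian elimination, one equation at a time: a pivot in equation \<open>d\<close>
  expresses one unknown through the others, and substituting it leaves a smaller system of the same
  kind.\<close>

lemma homogeneous_system_solvable:
  fixes a :: "'d \<Rightarrow> 'j \<Rightarrow> 'f::field"
  assumes "finite D" "finite J" "card D < card J"
  shows "\<exists>c. (\<exists>j\<in>J. c j \<noteq> 0) \<and> (\<forall>d\<in>D. (\<Sum>j\<in>J. a d j * c j) = 0)"
  using assms
proof (induction D arbitrary: J a rule: finite_induct)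
  case empty
  then have "J \<noteq> {}" by auto
  then show ?case by (intro exI[of _ "\<lambda>_. 1"]) auto
next
  case (insert d D)
  have cardD: "card D < card J" using insert by simp
  show ?case
  proof (cases "\<forall>j\<in>J. a d j = 0")
    case True
    then show ?thesis using insert.IH[OF \<open>finite J\<close> cardD, of a] by auto
  next
    case False
    then obtain i where i: "i \<in> J" "a d i \<noteq> 0" by blast
    define b where "b e j = a e j - a e i * a d j / a d i" for e j
    have "card D < card (J - {i})" using insert i by simp
    then obtain c where c: "\<exists>j\<in>J - {i}. c j \<noteq> 0"
        "\<And>e. e \<in> D \<Longrightarrow> (\<Sum>j\<in>J - {i}. b e j * c j) = 0"
      using insert.IH[of "J - {i}" b] insert.prems by auto
    define c' where "c' = c(i := - (\<Sum>j\<in>J - {i}. a d j * c j) / a d i)"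
    have sum: "(\<Sum>j\<in>J. a e j * c' j) = (\<Sum>j\<in>J - {i}. b e j * c j)" for e
    proof -
      have "(\<Sum>j\<in>J. a e j * c' j) = a e i * c' i + (\<Sum>j\<in>J - {i}. a e j * c' j)"
        using insert.prems i by (simp add: sum.remove)
      also have "(\<Sum>j\<in>J - {i}. a e j * c' j) = (\<Sum>j\<in>J - {i}. a e j * c j)"
        by (intro sum.cong) (auto simp: c'_def)
      also have "a e i * c' i = - (\<Sum>j\<in>J - {i}. a e i * a d j / a d i * c j)"
        by (simp add: c'_def sum_distrib_left sum_divide_distrib mult.assoc flip: sum_negf)
      finally show ?thesis
        by (simp add: b_def left_diff_distrib right_diff_distrib sum_subtractf sum_negf mult_ac)
    qed
    have "b d j = 0" for j using i by (simp add: b_def)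
    then have "(\<Sum>j\<in>J. a e j * c' j) = 0" if "e \<in> insert d D" for e
      using sum[of e] c(2)[of e] that by auto
    moreover have "\<exists>j\<in>J. c' j \<noteq> 0" using c(1) by (auto simp: c'_def)
    ultimately show ?thesis by blast
  qed
qed

text \<open>
  The incidence matrix of the sets \<open>K i\<close> against the sets \<open>T j\<close> is the all-ones
  matrix minus the identity, which is nonsingular.
\<close>

lemma card_le_of_near_transversals:
  fixes T K :: "'j \<Rightarrow> 'a set"
  assumes fin: "finite J" "finite D" and "card J \<noteq> 1"
    and finK: "\<And>i. i \<in> J \<Longrightarrow> finite (K i)"
    and self: "\<And>i. i \<in> J \<Longrightarrow> K i \<inter> T i = {}"
    and other: "\<And>i j. i \<in> J \<Longrightarrow> j \<in> J \<Longrightarrow> i \<noteq> j \<Longrightarrow> card (K i \<inter> T j) = 1"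
    and rep: "\<And>i z. i \<in> J \<Longrightarrow> z \<in> K i \<Longrightarrow> \<exists>d\<in>D. \<forall>j\<in>J. z \<in> T j \<longleftrightarrow> d \<in> T j"
  shows "card J \<le> card D"
proof (rule ccontr)
  assume "\<not> ?thesis"
  then obtain c :: "'j \<Rightarrow> rat" where c: "\<exists>j\<in>J. c j \<noteq> 0"
      and zero: "\<And>d. d \<in> D \<Longrightarrow> (\<Sum>j\<in>J. of_bool (d \<in> T j) * c j) = 0"
    using homogeneous_system_solvable[OF fin(2,1), of "\<lambda>d j. of_bool (d \<in> T j)"] by auto
  \<comment> \<open>Adding the vanishing row equations over all elements of \<open>K i\<close>
    counts every \<open>c j\<close> with \<open>j \<noteq> i\<close> once and \<open>c i\<close> not
    at all.\<close>
  have eq: "c i = sum c J" if i: "i \<in> J" for i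
  proof -
    have "(\<Sum>j\<in>J. of_bool (z \<in> T j) * c j) = 0" if z: "z \<in> K i" for z
    proof -
      obtain d where "d \<in> D" "\<forall>j\<in>J. z \<in> T j \<longleftrightarrow> d \<in> T j" using rep[OF i z] by blast
      then show ?thesis using zero[of d] by (simp cong: sum.cong)
    qed
    then have "0 = (\<Sum>z\<in>K i. \<Sum>j\<in>J. of_bool (z \<in> T j) * c j)" by simp
    also have "\<dots> = (\<Sum>j\<in>J. \<Sum>z\<in>K i. of_bool (z \<in> T j) * c j)" by (rule sum.swap)
    also have "\<dots> = (\<Sum>j\<in>J. of_nat (card (K i \<inter> T j)) * c j)"
    proof (intro sum.cong refl)
      fix j
      have "(\<Sum>z\<in>K i. of_bool (z \<in> T j) * c j) = (\<Sum>z\<in>K i \<inter> T j. c j)"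
        unfolding sum.inter_restrict[OF finK[OF i]] by (intro sum.cong) auto
      then show "(\<Sum>z\<in>K i. of_bool (z \<in> T j) * c j) = of_nat (card (K i \<inter> T j)) * c j" by simp
    qed
    also have "\<dots> = (\<Sum>j\<in>J - {i}. of_nat (card (K i \<inter> T j)) * c j)"
      using fin(1) i self[OF i] by (simp add: sum.remove)
    also have "\<dots> = (\<Sum>j\<in>J - {i}. c j)"
      using other[OF i] by (intro sum.cong) auto
    also have "\<dots> = sum c J - c i" using fin(1) i by (simp add: sum_diff1)
    finally show ?thesis by simp
  qed
  \<comment> \<open>All coefficients equal their total, so the total is \<open>card J\<close> times
    itself; as \<open>card J \<noteq> 1\<close>, it vanishes, and every coefficient with it.\<close>
  have "sum c J = (\<Sum>j\<in>J. sum c J)" by (rule sum.cong[OF refl eq])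
  then have "sum c J = of_nat (card J) * sum c J" unfolding sum_constant .
  then have "sum c J = 0" using \<open>card J \<noteq> 1\<close> by simp
  then show False using c eq by metis
qed

lemma card_color_classes:
  assumes "finite A" "\<And>z. z \<in> A \<Longrightarrow> c z < (n::nat)"
  shows "(\<Sum>i<n. card {z\<in>A. c z = i}) = card A"
  using sum.group[of A "{..<n}" c "\<lambda>_. 1::nat"] assms by auto


section \<open>Minimal imperfect vertex sets\<close>

locale adjacency =
  fixes adj :: "'a \<Rightarrow> 'a \<Rightarrow> bool"
  assumes adj_sym: "adj x y \<Longrightarrow> adj y x" and adj_irrefl [simp]: "\<not> adj x x"
begin

definition stable :: "'a set \<Rightarrow> bool" where
  "stable S \<longleftrightarrow> (\<forall>x\<in>S. \<forall>y\<in>S. \<not> adj x y)"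

definition clq :: "'a set \<Rightarrow> bool" where
  "clq K \<longleftrightarrow> (\<forall>x\<in>K. \<forall>y\<in>K. x \<noteq> y \<longrightarrow> adj x y)"

definition wom :: "('a \<Rightarrow> nat) \<Rightarrow> 'a set \<Rightarrow> nat" where
  "wom w X = Max (sum w ` {K. K \<subseteq> X \<and> clq K})"

definition om :: "'a set \<Rightarrow> nat" where
  "om = wom (\<lambda>_. 1)"

definition coloring :: "'a set \<Rightarrow> nat \<Rightarrow> ('a \<Rightarrow> nat) \<Rightarrow> bool" where
  "coloring X n c \<longleftrightarrow> (\<forall>x\<in>X. c x < n) \<and> (\<forall>x\<in>X. \<forall>y\<in>X. adj x y \<longrightarrow> c x \<noteq> c y)"

definition colorable :: "'a set \<Rightarrow> nat \<Rightarrow> bool" where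
  "colorable X n \<longleftrightarrow> (\<exists>c. coloring X n c)"

text \<open>Asking for a coloring with \<open>om Y\<close> colors expresses equality, since a
  largest clique forbids fewer colors.\<close>

definition perf :: "'a set \<Rightarrow> bool" where
  "perf X \<longleftrightarrow> (\<forall>Y\<subseteq>X. colorable Y (om Y))"

definition minimp :: "'a set \<Rightarrow> bool" where
  "minimp F \<longleftrightarrow> finite F \<and> \<not> colorable F (om F) \<and> (\<forall>Y. Y \<subset> F \<longrightarrow> colorable Y (om Y))"

definition homogeneous :: "'a set \<Rightarrow> 'a set \<Rightarrow> bool" where
  "homogeneous X V \<longleftrightarrow> X \<subseteq> V \<and> 2 \<le> card X \<and> X \<noteq> V \<and>
     (\<forall>y\<in>V - X. (\<forall>x\<in>X. adj y x) \<or> (\<forall>x\<in>X. \<not> adj y x))"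

text \<open>Connectedness by cuts instead of paths, so that a vertex mixed on the set yields a mixed
  edge at once.\<close>

definition conn :: "'a set \<Rightarrow> bool" where
  "conn X \<longleftrightarrow> (\<forall>S\<subseteq>X. S \<noteq> {} \<and> S \<noteq> X \<longrightarrow> (\<exists>x\<in>S. \<exists>y\<in>X - S. adj x y))"

lemma clq_subset: "clq K \<Longrightarrow> L \<subseteq> K \<Longrightarrow> clq L"
  unfolding clq_def by blast

lemma wom_ge: "finite X \<Longrightarrow> K \<subseteq> X \<Longrightarrow> clq K \<Longrightarrow> sum w K \<le> wom w X"
  unfolding wom_def by (intro Max_ge) auto

lemma wom_attained:
  assumes "finite X"
  obtains K where "K \<subseteq> X" "clq K" "sum w K = wom w X"
proof -
  have "{} \<in> {K. K \<subseteq> X \<and> clq K}" by (simp add: clq_def)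
  then have "wom w X \<in> sum w ` {K. K \<subseteq> X \<and> clq K}"
    unfolding wom_def using assms by (intro Max_in) auto
  then show ?thesis using that by auto
qed

lemma om_ge: "finite X \<Longrightarrow> K \<subseteq> X \<Longrightarrow> clq K \<Longrightarrow> card K \<le> om X"
  using wom_ge[of X K "\<lambda>_. 1"] by (simp add: om_def)

lemma om_attained:
  assumes "finite X"
  obtains K where "K \<subseteq> X" "clq K" "card K = om X"
  using wom_attained[OF assms, of "\<lambda>_. 1"] by (auto simp: om_def)

lemma om_mono: "finite Y \<Longrightarrow> X \<subseteq> Y \<Longrightarrow> om X \<le> om Y"
  by (metis finite_subset om_attained om_ge subset_trans)

lemma coloring_mono: "coloring X n c \<Longrightarrow> n \<le> m \<Longrightarrow> coloring X m c"
  unfolding coloring_def by (meson order.strict_trans2)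

lemma colorable_mono: "colorable X n \<Longrightarrow> n \<le> m \<Longrightarrow> colorable X m"
  unfolding colorable_def using coloring_mono by blast

lemma coloring_clq_inj: "coloring X n c \<Longrightarrow> K \<subseteq> X \<Longrightarrow> clq K \<Longrightarrow> inj_on c K"
  unfolding coloring_def clq_def inj_on_def by (meson subsetD)

lemma coloring_clq_surj:
  assumes "coloring X n c" "K \<subseteq> X" "clq K" "card K = n"
  shows "c ` K = {..<n}"
proof (rule card_subset_eq)
  show "c ` K \<subseteq> {..<n}" using assms(1,2) by (auto simp: coloring_def)
  show "card (c ` K) = card {..<n}"
    using coloring_clq_inj[OF assms(1-3)] assms(4) by (simp add: card_image)
qed auto

lemma stable_color_class: "coloring X n c \<Longrightarrow> stable {x\<in>X. c x = i}"
  unfolding coloring_def stable_def by (metis (mono_tags, lifting) mem_Collect_eq)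

lemma coloring_extend_stable:
  assumes c: "coloring (X - S) n c" and S: "stable S"
  shows "coloring X (Suc n) (\<lambda>x. if x \<in> S then n else c x)"
  unfolding coloring_def
proof (intro conjI ballI impI)
  fix x y assume xy: "x \<in> X" "y \<in> X" "adj x y"
  have "c z < n" if "z \<in> X - S" for z using c that by (simp add: coloring_def)
  then have "c z \<noteq> n" if "z \<in> X" "z \<notin> S" for z using that by blast
  moreover have "x \<notin> S \<Longrightarrow> y \<notin> S \<Longrightarrow> c x \<noteq> c y" using c xy by (simp add: coloring_def)
  moreover have "\<not> (x \<in> S \<and> y \<in> S)" using S xy by (auto simp: stable_def)
  ultimately show "(if x \<in> S then n else c x) \<noteq> (if y \<in> S then n else c y)"
    using xy by metis
qed (use c in \<open>auto simp: coloring_def less_Suc_eq\<close>)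

lemma stable_singleton [simp]: "stable {x}"
  by (simp add: stable_def)

lemma card_clq_Int_stable:
  assumes "clq K" "stable S"
  shows "card (K \<inter> S) \<le> 1"
proof (rule ccontr)
  assume "\<not> card (K \<inter> S) \<le> 1"
  then obtain x y where "x \<in> K \<inter> S" "y \<in> K \<inter> S" "x \<noteq> y"
    by (metis card_le_Suc0_iff_eq One_nat_def card.infinite le0)
  then show False using assms by (auto simp: clq_def stable_def)
qed

section \<open>Cliques and homogeneous sets in minimal imperfect sets\<close>

lemma not_perf_obtains_minimp:
  assumes "finite X" "\<not> perf X"
  obtains F where "F \<subseteq> X" "minimp F"
proof -
  let ?A = "{Y. Y \<subseteq> X \<and> \<not> colorable Y (om Y)}"
  have "finite ?A" "?A \<noteq> {}" using assms by (auto simp: perf_def)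
  then obtain F where F: "F \<in> ?A" "\<forall>Y\<in>?A. Y \<subseteq> F \<longrightarrow> F = Y"
    using finite_has_minimal[of ?A] by blast
  then have "minimp F"
    using assms(1) by (auto simp: minimp_def intro: finite_subset)
  then show ?thesis using F that by auto
qed

lemma minimp_coloring:
  assumes "minimp F" "Y \<subset> F"
  obtains c where "coloring Y (om F) c"
  using assms om_mono[of F Y] unfolding minimp_def colorable_def
  by (meson coloring_mono psubset_imp_subset)

lemma perf_no_minimp: "perf X \<Longrightarrow> F \<subseteq> X \<Longrightarrow> \<not> minimp F"
  by (auto simp: perf_def minimp_def)

text \<open>If every largest clique of \<open>F\<close> met \<open>S\<close>, then
  \<open>F - S\<close> would have smaller clique number, and an optimal coloring of it with
  \<open>S\<close> as one more class would color \<open>F\<close> with \<open>om F\<close>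
  colors.\<close>

lemma minimp_clq_avoids_stable:
  assumes F: "minimp F" and S: "S \<subseteq> F" "stable S"
  obtains K where "K \<subseteq> F - S" "clq K" "card K = om F"
proof (cases "S = {}")
  case True
  then show ?thesis using that F om_attained[of F] by (auto simp: minimp_def)
next
  case False
  have fin: "finite F" using F by (simp add: minimp_def)
  obtain K where K: "K \<subseteq> F - S" "clq K" "card K = om (F - S)"
    using om_attained[of "F - S"] fin by blast
  have "om (F - S) = om F"
  proof (rule ccontr)
    assume "om (F - S) \<noteq> om F"
    then have lt: "Suc (om (F - S)) \<le> om F" using om_mono[of F "F - S"] fin by auto
    have "F - S \<subset> F" using False S by auto
    then obtain c where c: "coloring (F - S) (om (F - S)) c"
      using F unfolding minimp_def colorable_def by blast
    have "colorable F (Suc (om (F - S)))"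
      using coloring_extend_stable[OF c S(2)] unfolding colorable_def by blast
    then have "colorable F (om F)" using lt colorable_mono by blast
    then show False using F by (simp add: minimp_def)
  qed
  then show ?thesis using that K by simp
qed

text \<open>Lovasz's substitution argument. In a clique \<open>X\<close> two vertices are adjacent
  twins, and a color class is shifted from one to the other; otherwise \<open>X\<close> is thinned
  out to a largest clique before coloring, then recolored optimally with the colors of that
  clique.\<close>

lemma minimp_not_homogeneous:
  assumes F: "minimp F" and X: "homogeneous X F"
  shows False
proof (cases "clq X")
  case True
  have fin: "finite F" using F by (simp add: minimp_def)
  have "2 \<le> card X" using X by (simp add: homogeneous_def)
  then obtain x x' where x: "x \<in> X" "x' \<in> X" "x \<noteq> x'"
    by (metis One_nat_def card_le_Suc0_iff_eq card.infinite not_less_eq_eq numeral_2_eq_2 zero_le)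
  have xF: "x \<in> F" "x' \<in> F" using x X by (auto simp: homogeneous_def)
  have twin: "adj y x \<longleftrightarrow> adj y x'" if "y \<in> F" "y \<noteq> x" "y \<noteq> x'" for y
    using that X x True unfolding homogeneous_def clq_def by (metis DiffI)
  have xx: "adj x x'" "adj x' x" using True x by (auto simp: clq_def)
  obtain c where c: "coloring (F - {x'}) (om (F - {x'})) c"
    using F xF unfolding minimp_def colorable_def by blast
  show False
  proof (cases "om (F - {x'}) = om F")
    case False
    then have lt: "Suc (om (F - {x'})) \<le> om F" using om_mono[of F "F - {x'}"] fin by auto
    have "colorable F (Suc (om (F - {x'})))"
      using coloring_extend_stable[OF c stable_singleton] unfolding colorable_def by blast
    then have "colorable F (om F)" using lt colorable_mono by blast
    then show False using F by (simp add: minimp_def)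
  next
    case eq: True
    \<comment> \<open>The color class of \<open>x\<close> with \<open>x\<close> exchanged for its
      twin \<open>x'\<close>. A largest clique avoiding it still needs the color of \<open>x\<close>
      and can get it only from \<open>x\<close> itself; then \<open>x'\<close> enlarges the
      clique.\<close>
    define S where "S = insert x' ({y \<in> F - {x'}. c y = c x} - {x})"
    have nadj: "\<not> adj y x'" if "y \<in> F" "y \<noteq> x" "y \<noteq> x'" "c y = c x" for y
      using that c xF x twin[of y] by (auto simp: coloring_def)
    have "stable S"
      unfolding stable_def
    proof (intro ballI notI)
      fix y z assume yz: "y \<in> S" "z \<in> S" "adj y z"
      show False
      proof (cases "y = x' \<or> z = x'")
        case True
        then show False using yz nadj[of y] nadj[of z] adj_sym[OF yz(3)] by (auto simp: S_def)
      next
        case False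
        then have "y \<in> F - {x'}" "z \<in> F - {x'}" "c y = c z" using yz by (auto simp: S_def)
        then show False using c yz(3) by (auto simp: coloring_def)
      qed
    qed
    moreover have "S \<subseteq> F" using xF by (auto simp: S_def)
    ultimately obtain K where K: "K \<subseteq> F - S" "clq K" "card K = om F"
      using minimp_clq_avoids_stable[OF F] by blast
    have KF: "K \<subseteq> F - {x'}" using K(1) by (auto simp: S_def)
    have "c ` K = {..<om F}" using coloring_clq_surj[OF c KF K(2)] K(3) eq by simp
    moreover have "c x < om F" using c eq xF x by (auto simp: coloring_def)
    ultimately obtain k where "k \<in> K" "c k = c x" by (metis imageE lessThan_iff)
    then have xK: "x \<in> K" using K(1) by (auto simp: S_def)
    have "adj y x'" if "y \<in> K" for y
    proof (cases "y = x")
      case False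
      then have "adj y x" using that xK K(2) by (auto simp: clq_def)
      then show ?thesis using twin[of y] that False KF by blast
    qed (use xx in simp)
    then have "clq (insert x' K)" using K(2) adj_sym by (auto simp: clq_def)
    moreover have "insert x' K \<subseteq> F" using KF xF by auto
    ultimately have "card (insert x' K) \<le> om F" using fin om_ge by blast
    moreover have "card (insert x' K) = Suc (om F)"
      using KF K(3) fin by (subst card_insert_disjoint) (auto intro: finite_subset)
    ultimately show False by simp
  qed
next
  case False
  have fin: "finite F" using F by (simp add: minimp_def)
  have XF: "X \<subset> F" using X by (auto simp: homogeneous_def)
  then have finX: "finite X" using fin finite_subset by blast
  obtain K where K: "K \<subseteq> X" "clq K" "card K = om X" using om_attained[OF finX] by blast
  have "K \<noteq> X" using K False by auto
  then have "(F - X) \<union> K \<subset> F" using K XF by auto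
  then obtain c where c: "coloring ((F - X) \<union> K) (om F) c" using minimp_coloring[OF F] by blast
  obtain d where d: "coloring X (om X) d"
    using F XF unfolding minimp_def colorable_def by blast
  have "card (c ` K) = om X" using coloring_clq_inj[OF c _ K(2)] K(3) by (simp add: card_image)
  then obtain h where h: "bij_betw h {..<om X} (c ` K)"
    using finite_same_card_bij[of "{..<om X}" "c ` K"] finite_subset[OF K(1) finX] by auto
  define e where "e y = (if y \<in> X then h (d y) else c y)" for y
  have hd: "h (d y) \<in> c ` K" if "y \<in> X" for y
    using that d h by (auto simp: coloring_def bij_betw_def)
  \<comment> \<open>A vertex outside \<open>X\<close> with a neighbor in \<open>X\<close> is
    complete to \<open>X\<close>, so its color does not occur on \<open>K\<close>, where all the
    colors used for \<open>X\<close> come from.\<close>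
  have cross: "c y \<noteq> h (d z)" if "y \<in> F - X" "z \<in> X" "adj y z" for y z
  proof -
    have "\<forall>k\<in>X. adj y k" using X that by (auto simp: homogeneous_def)
    moreover obtain k where "k \<in> K" "h (d z) = c k" using hd[OF \<open>z \<in> X\<close>] by auto
    ultimately show ?thesis using c that K(1) by (auto simp: coloring_def)
  qed
  have "e y < om F" if "y \<in> F" for y
    using hd[of y] c that by (auto simp: coloring_def e_def)
  moreover have "e y \<noteq> e z" if yz: "y \<in> F" "z \<in> F" "adj y z" for y z
  proof (cases "y \<in> X \<and> z \<in> X")
    case True
    then have "d y \<noteq> d z" "d y < om X" "d z < om X" using d yz by (auto simp: coloring_def)
    then show ?thesis using True h by (auto simp: e_def bij_betw_def inj_on_def)
  next
    case False
    then consider "y \<notin> X" "z \<in> X" | "y \<in> X" "z \<notin> X" | "y \<notin> X" "z \<notin> X" by blast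
    then show ?thesis
    proof cases
      case 1 then show ?thesis using cross[of y z] yz by (simp add: e_def)
    next
      case 2 then show ?thesis using cross[of z y] yz adj_sym by (force simp: e_def)
    next
      case 3 then show ?thesis using c yz by (auto simp: e_def coloring_def)
    qed
  qed
  ultimately have "coloring F (om F) e" by (auto simp: coloring_def)
  then show False using F by (auto simp: minimp_def colorable_def)
qed

section \<open>Connectivity of minimal imperfect sets\<close>

lemma conn_insert:
  assumes "conn X" "x \<in> X" "adj y x"
  shows "conn (insert y X)"
  unfolding conn_def
proof (intro allI impI, elim conjE)
  fix S assume S: "S \<subseteq> insert y X" "S \<noteq> {}" "S \<noteq> insert y X"
  consider "S \<inter> X = {}" | "S \<inter> X = X" | "S \<inter> X \<noteq> {}" "S \<inter> X \<noteq> X" by blast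
  then show "\<exists>a\<in>S. \<exists>b\<in>insert y X - S. adj a b"
  proof cases
    case 1
    then have "S = {y}" "x \<notin> S" using S assms by auto
    then show ?thesis using assms by auto
  next
    case 2
    then have "y \<notin> S" "x \<in> S" using S assms by auto
    then show ?thesis using assms adj_sym by blast
  next
    case 3
    then obtain a b where "a \<in> S \<inter> X" "b \<in> X - (S \<inter> X)" "adj a b"
      using assms(1) unfolding conn_def by (meson inf_le2)
    then show ?thesis by blast
  qed
qed

lemma conn_edge: "adj a b \<Longrightarrow> conn {a, b}"
  using conn_insert[of "{b}" b a] by (auto simp: conn_def)

lemma conn_mixed_edge:
  assumes "conn X" "x \<in> X" "adj y x" "z \<in> X" "\<not> adj y z"
  obtains a b where "a \<in> X" "b \<in> X" "adj a b" "adj y a" "\<not> adj y b"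
proof -
  let ?S = "{a\<in>X. adj y a}"
  have "?S \<subseteq> X" "?S \<noteq> {}" "?S \<noteq> X" using assms by auto
  then obtain a b where "a \<in> ?S" "b \<in> X - ?S" "adj a b"
    using assms(1) unfolding conn_def by meson
  then show ?thesis using that by auto
qed

lemma minimp_conn:
  assumes F: "minimp F"
  shows "conn F"
  unfolding conn_def
proof (intro allI impI, elim conjE, rule ccontr)
  fix S assume S: "S \<subseteq> F" "S \<noteq> {}" "S \<noteq> F" and no: "\<not> (\<exists>x\<in>S. \<exists>y\<in>F - S. adj x y)"
  obtain c where c: "coloring S (om F) c" using minimp_coloring[OF F] S by blast
  obtain d where d: "coloring (F - S) (om F) d" using minimp_coloring[OF F, of "F - S"] S by blast
  have "coloring F (om F) (\<lambda>x. if x \<in> S then c x else d x)"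
    using c d no adj_sym unfolding coloring_def by (auto dest: adj_sym)
  then show False using F by (auto simp: minimp_def colorable_def)
qed

lemma minimp_card:
  assumes F: "minimp F"
  shows "2 \<le> card F"
proof (rule ccontr)
  assume "\<not> 2 \<le> card F"
  then have "card F \<le> 1" by simp
  moreover have "finite F" using F by (simp add: minimp_def)
  ultimately have F1: "\<And>x y. x \<in> F \<Longrightarrow> y \<in> F \<Longrightarrow> x = y" by (simp add: card_le_Suc0_iff_eq)
  have "clq F" using F1 by (auto simp: clq_def)
  then have "card F \<le> om F" using om_ge \<open>finite F\<close> by blast
  moreover have "\<not> adj x y" if "x \<in> F" "y \<in> F" for x y
    using F1[OF that] by auto
  moreover have "0 < card F" if "x \<in> F" for x
    using \<open>finite F\<close> that card_gt_0_iff by blast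
  ultimately have "coloring F (om F) (\<lambda>_. 0)"
    unfolding coloring_def by (meson order.strict_trans2)
  then show False using F by (auto simp: minimp_def colorable_def)
qed

lemma minimp_om:
  assumes F: "minimp F"
  shows "2 \<le> om F"
proof -
  have fin: "finite F" using F by (simp add: minimp_def)
  obtain x where x: "x \<in> F" using minimp_card[OF F] by fastforce
  have "{x} \<noteq> F" using minimp_card[OF F] by auto
  then obtain y where y: "y \<in> F" "adj x y"
    using minimp_conn[OF F] x unfolding conn_def by (metis Diff_iff empty_not_insert empty_subsetI insert_subset singletonD)
  then have "clq {x, y}" "card {x, y} = 2" "{x, y} \<subseteq> F"
    using x adj_sym by (auto simp: clq_def card_insert_if)
  then show ?thesis using om_ge[OF fin] by metis
qed

text \<open>A maximal connected subset of \<open>T\<close> containing \<open>a\<close> and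
  \<open>b\<close> would be homogeneous in \<open>F\<close>: a vertex of \<open>T\<close> mixed on
  it could be added, and a vertex outside \<open>T\<close> mixed on it would separate an edge of
  \<open>T\<close>, against \<open>no\<close>.\<close>

lemma minimp_no_component:
  assumes F: "minimp F" and T: "T \<subset> F" and ab: "a \<in> T" "b \<in> T" "adj a b"
    and no: "\<And>x y z. y \<in> F - T \<Longrightarrow> x \<in> T \<Longrightarrow> z \<in> T \<Longrightarrow> adj x z \<Longrightarrow> adj y x \<Longrightarrow> adj y z"
  shows False
proof -
  have fin: "finite F" using F by (simp add: minimp_def)
  let ?A = "{K. K \<subseteq> T \<and> conn K}"
  have "finite ?A" using fin T by (simp add: finite_subset[of T F] psubset_imp_subset)
  moreover have "{a, b} \<in> ?A" using ab conn_edge by auto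
  ultimately obtain K where K: "K \<in> ?A" "{a, b} \<subseteq> K" "\<forall>L\<in>?A. K \<subseteq> L \<longrightarrow> K = L"
    using finite_has_maximal2[of ?A "{a, b}"] by blast
  have "homogeneous K F"
    unfolding homogeneous_def
  proof (intro conjI ballI)
    show "K \<subseteq> F" "K \<noteq> F" using K T by auto
    have "a \<noteq> b" using ab by auto
    then have "card {a, b} = 2" by simp
    then show "2 \<le> card K"
      using K(2) card_mono[of K "{a, b}"] finite_subset[of K F] fin \<open>K \<subseteq> F\<close> by simp
    fix y assume y: "y \<in> F - K"
    show "(\<forall>x\<in>K. adj y x) \<or> (\<forall>x\<in>K. \<not> adj y x)"
    proof (rule ccontr)
      assume "\<not> ?thesis"
      then obtain p q where pq: "p \<in> K" "adj y p" "q \<in> K" "\<not> adj y q" by blast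
      show False
      proof (cases "y \<in> T")
        case True
        then have "insert y K \<in> ?A" using K(1) conn_insert[OF _ pq(1,2)] by simp
        then have "K = insert y K" using K(3) by blast
        then show False using y by auto
      next
        case False
        obtain x z where "x \<in> K" "z \<in> K" "adj x z" "adj y x" "\<not> adj y z"
          using conn_mixed_edge[of K p y q] pq K(1) by blast
        then show False using no[of y x z] False y K(1) by blast
      qed
    qed
  qed
  then show False using minimp_not_homogeneous F by blast
qed


section \<open>Rank bounds in the style of Gasparyan\<close>

text \<open>The stable sets are \<open>S\<close> and, for each \<open>s\<close> in \<open>S\<close>,
  the \<open>om F\<close> color classes of \<open>F - {s}\<close>. Each is avoided by a clique of
  size \<open>om F\<close>, which meets all the others exactly once, so the rank bound applies. A
  vertex outside \<open>D\<close> is represented by a vertex of \<open>D\<close> with the same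
  row.\<close>

lemma minimp_card_lower:
  assumes F: "minimp F" and S: "S \<subseteq> F" "stable S" "S \<noteq> {}"
    and c: "\<And>s. s \<in> S \<Longrightarrow> coloring (F - {s}) (om F) (c s)"
    and D: "D \<subseteq> F"
    and rep: "\<And>z. z \<in> F - D \<Longrightarrow>
      \<exists>d\<in>D. z \<notin> S \<and> d \<notin> S \<and> (\<forall>s\<in>S. c s z = c s d)"
  shows "card S * om F + 1 \<le> card D"
proof -
  have fin: "finite F" using F by (simp add: minimp_def)
  then have finS: "finite S" using S(1) finite_subset by blast
  \<comment> \<open>\<open>None\<close> stands for \<open>S\<close>, and \<open>Some (s, i)\<close>
    for the class of color \<open>i\<close> in \<open>F - {s}\<close>.\<close>
  define J where "J = insert None (Some ` (S \<times> {..<om F}))"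
  define T where "T j = (case j of None \<Rightarrow> S | Some (s, i) \<Rightarrow> {z \<in> F - {s}. c s z = i})" for j
  have finJ: "finite J" using finS by (simp add: J_def)
  have cardJ: "card J = card S * om F + 1"
    using finS unfolding J_def by (subst card_insert_disjoint) (auto simp: card_image)
  have stT: "stable (T j)" "T j \<subseteq> F" if "j \<in> J" for j
    using that S stable_color_class[OF c] by (auto simp: J_def T_def)
  have "\<exists>K. K \<subseteq> F - T j \<and> clq K \<and> card K = om F" if "j \<in> J" for j
    using minimp_clq_avoids_stable[OF F stT(2,1)[OF that]] by metis
  then obtain K where K: "\<And>j. j \<in> J \<Longrightarrow> K j \<subseteq> F - T j \<and> clq (K j) \<and> card (K j) = om F"
    by metis
  \<comment> \<open>Each \<open>s\<close> accounts for exactly \<open>om F\<close>: its classes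
    cover \<open>L - {s}\<close>, and if \<open>s\<close> lies in \<open>L\<close>, the missing 1
    comes from \<open>L \<inter> S\<close>.\<close>
  have total: "(\<Sum>j\<in>J. card (L \<inter> T j)) = card S * om F"
    if L: "L \<subseteq> F" "clq L" "card L = om F" for L
  proof -
    have finL: "finite L" using L fin finite_subset by blast
    have "(\<Sum>j\<in>J. card (L \<inter> T j)) = card (L \<inter> S) + (\<Sum>p\<in>S \<times> {..<om F}. card (L \<inter> T (Some p)))"
      unfolding J_def using finS by (subst sum.insert) (auto simp: sum.reindex T_def)
    also have "(\<Sum>p\<in>S \<times> {..<om F}. card (L \<inter> T (Some p))) =
        (\<Sum>s\<in>S. \<Sum>i<om F. card (L \<inter> T (Some (s, i))))"
      by (simp add: sum.cartesian_product)
    also have "\<dots> = (\<Sum>s\<in>S. card (L - {s}))"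
    proof (intro sum.cong refl)
      fix s assume s: "s \<in> S"
      have "L \<inter> T (Some (s, i)) = {z \<in> L - {s}. c s z = i}" for i
        using L by (auto simp: T_def)
      moreover have "(\<Sum>i<om F. card {z \<in> L - {s}. c s z = i}) = card (L - {s})"
        using c[OF s] L(1) finL by (intro card_color_classes) (auto simp: coloring_def)
      ultimately show "(\<Sum>i<om F. card (L \<inter> T (Some (s, i)))) = card (L - {s})" by simp
    qed
    also have "card (L \<inter> S) = (\<Sum>s\<in>S. of_bool (s \<in> L))"
      using finS by (simp add: of_bool_def sum.If_cases Int_commute Int_def)
    also have "(\<Sum>s\<in>S. of_bool (s \<in> L)) + (\<Sum>s\<in>S. card (L - {s})) =
        (\<Sum>s\<in>S. of_bool (s \<in> L) + card (L - {s}))"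
      by (simp only: sum.distrib)
    also have "\<dots> = (\<Sum>s\<in>S. om F)"
    proof (intro sum.cong refl)
      fix s
      show "of_bool (s \<in> L) + card (L - {s}) = om F"
        using L(3) finL card_Suc_Diff1[OF finL, of s] by (cases "s \<in> L") auto
    qed
    finally show ?thesis by simp
  qed
  have one: "card (K i \<inter> T j) = 1" if ij: "i \<in> J" "j \<in> J" "i \<noteq> j" for i j
  proof (rule ccontr)
    \<comment> \<open>A second missed set would leave at most \<open>card J - 2\<close> incidences,
      one fewer than \<open>card S * om F\<close>.\<close>
    assume "card (K i \<inter> T j) \<noteq> 1"
    then have "card (K i \<inter> T j) = 0"
      using card_clq_Int_stable[of "K i" "T j"] K[OF ij(1)] stT[OF ij(2)] by linarith
    moreover have "card (K i \<inter> T i) = 0" using K[OF ij(1)] by (metis Diff_disjoint Int_commute card.empty disjoint_iff subsetD)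
    ultimately have "(\<Sum>l\<in>J. card (K i \<inter> T l)) = (\<Sum>l\<in>J - {i, j}. card (K i \<inter> T l))"
      using finJ by (intro sum.mono_neutral_right) auto
    also have "\<dots> \<le> card (J - {i, j}) * 1"
      using card_clq_Int_stable K[OF ij(1)] stT(1) by (intro sum_bounded_above[THEN order_trans]) auto
    also have "card (J - {i, j}) < card S * om F"
    proof -
      have "card (J - {i, j}) = card J - 2" using ij by (subst card_Diff_subset) auto
      moreover have "0 < card S * om F"
        using finS S(3) minimp_om[OF F] by (simp add: card_gt_0_iff)
      ultimately show ?thesis using cardJ by simp
    qed
    finally show False using total[of "K i"] K[OF ij(1)] by auto
  qed
  have "card J \<le> card D"
  proof (rule card_le_of_near_transversals[of J D K T])
    show "card J \<noteq> 1" using cardJ finS S(3) minimp_om[OF F] by auto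
    show "finite D" using D fin finite_subset by blast
    fix i assume i: "i \<in> J"
    show "finite (K i)" using K[OF i] fin finite_subset by blast
    show "K i \<inter> T i = {}" using K[OF i] by blast
    fix z assume z: "z \<in> K i"
    show "\<exists>d\<in>D. \<forall>j\<in>J. z \<in> T j \<longleftrightarrow> d \<in> T j"
    proof (cases "z \<in> D")
      case False
      then obtain d where "d \<in> D" "z \<notin> S" "d \<notin> S" "\<forall>s\<in>S. c s z = c s d"
        using rep[of z] z K[OF i] by auto
      then have "\<forall>j\<in>J. z \<in> T j \<longleftrightarrow> d \<in> T j"
        using D K[OF i] z by (auto simp: J_def T_def)
      then show ?thesis using \<open>d \<in> D\<close> by blast
    qed blast
  qed (use finJ one in auto)
  then show ?thesis using cardJ by simp
qed

text \<open>
  If \<open>x\<close> and \<open>y\<close> always share a color, their rows in the incidence system above coincide,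
  so one of them can be dropped; this contradicts the upper bound \<open>\<alpha>\<omega> + 1\<close> on the
  number of vertices.
\<close>

lemma minimp_no_monochromatic_pair:
  assumes F: "minimp F" and xy: "x \<in> F" "y \<in> F" "x \<noteq> y" "\<not> adj x y"
    and mono: "\<And>z. z \<in> F \<Longrightarrow> z \<noteq> x \<Longrightarrow> z \<noteq> y \<Longrightarrow>
      \<exists>c. coloring (F - {z}) (om F) c \<and> c x = c y"
  shows False
proof -
  have fin: "finite F" using F by (simp add: minimp_def)
  have om2: "2 \<le> om F" using minimp_om[OF F] .
  have st2: "stable {x, y}" using xy(4) adj_sym by (auto simp: stable_def)
  have "\<exists>S. (S \<subseteq> F \<and> stable S) \<and> (\<forall>S'. S' \<subseteq> F \<and> stable S' \<longrightarrow> card S' \<le> card S)"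
  proof (rule ex_has_greatest_nat)
    show "{x, y} \<subseteq> F \<and> stable {x, y}" using st2 xy(1,2) by simp
    show "\<forall>S. S \<subseteq> F \<and> stable S \<longrightarrow> card S < Suc (card F)"
      using fin by (simp add: card_mono less_Suc_eq_le)
  qed
  then obtain S where S: "S \<subseteq> F" "stable S"
      and max: "\<And>S'. S' \<subseteq> F \<Longrightarrow> stable S' \<Longrightarrow> card S' \<le> card S" by blast
  have S2: "2 \<le> card S" using max[of "{x, y}"] st2 xy by auto
  then have "S \<noteq> {}" by auto
  have "\<exists>c. coloring (F - {s}) (om F) c" if "s \<in> S" for s
    using minimp_coloring[OF F, of "F - {s}"] that S(1) by blast
  then obtain c where "\<And>s. s \<in> S \<Longrightarrow> coloring (F - {s}) (om F) (c s)" by metis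
  then have lower: "card S * om F + 1 \<le> card F"
    using minimp_card_lower[OF F S \<open>S \<noteq> {}\<close>, of c F] by auto
  \<comment> \<open>With \<open>lower\<close>, the upper bound fixes the size of \<open>F\<close>,
    which leaves no room for a color class smaller than \<open>S\<close> in any coloring of any
    \<open>F - {z}\<close>.\<close>
  have upper: "card F \<le> card S * om F + 1" and
    large: "\<And>d z i. z \<in> F \<Longrightarrow> coloring (F - {z}) (om F) d \<Longrightarrow> i < om F \<Longrightarrow>
      card S \<le> card {t \<in> F - {z}. d t = i}"
  proof -
    have le: "card {t \<in> F - {z}. d t = i} \<le> card S" if "coloring (F - {z}) (om F) d" for d z i
      using max[OF _ stable_color_class[OF that]] by blast
    have sum: "(\<Sum>i<om F. card {t \<in> F - {z}. d t = i}) = card F - 1"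
      if "coloring (F - {z}) (om F) d" "z \<in> F" for d z
      using card_color_classes[of "F - {z}" d "om F"] that fin by (auto simp: coloring_def)
    show "card F \<le> card S * om F + 1"
    proof -
      obtain d where d: "coloring (F - {x}) (om F) d"
        using minimp_coloring[OF F, of "F - {x}"] xy by blast
      have "(\<Sum>i<om F. card {t \<in> F - {x}. d t = i}) \<le> (\<Sum>i<om F. card S)"
        by (intro sum_mono le d)
      then show ?thesis using sum[OF d] xy by (simp add: mult.commute)
    qed
    fix d z i assume z: "z \<in> F" and d: "coloring (F - {z}) (om F) d" and i: "i < om F"
    show "card S \<le> card {t \<in> F - {z}. d t = i}"
    proof (rule ccontr)
      assume "\<not> ?thesis"
      then have "(\<Sum>i<om F. card {t \<in> F - {z}. d t = i}) < (\<Sum>i<om F. card S)"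
        using i by (intro sum_strict_mono_ex1 ballI le d bexI[of _ i]) auto
      then show False using sum[OF d z] lower by (simp add: mult.commute)
    qed
  qed
  have "4 \<le> card S * om F" using mult_le_mono[OF S2 om2] by simp
  then have "card {x, y} < card F" using lower card_insert_le_m1[of 2 "{y}" x] by simp
  then have "\<not> F \<subseteq> {x, y}" using card_mono[of "{x, y}" F] by auto
  then obtain z where z: "z \<in> F" "z \<noteq> x" "z \<noteq> y" by auto
  then obtain d where d: "coloring (F - {z}) (om F) d" "d x = d y" using mono by blast
  obtain i where i: "i < om F" "i \<noteq> d x"
  proof (cases "d x = 0")
    case True then show ?thesis using that[of 1] om2 by simp
  next
    case False then show ?thesis using that[of 0] om2 by simp
  qed
  \<comment> \<open>A class of a color other than that of \<open>x\<close> and \<open>y\<close>: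
    again a largest stable set, but one that avoids both.\<close>
  define S' where "S' = {t \<in> F - {z}. d t = i}"
  have S': "S' \<subseteq> F" "stable S'" using stable_color_class[OF d(1)] by (auto simp: S'_def)
  have cardS': "card S \<le> card S'" using large[OF z(1) d(1) i(1)] by (simp add: S'_def)
  then have "S' \<noteq> {}" using S2 by auto
  have xyS': "x \<notin> S'" "y \<notin> S'" using d i by (auto simp: S'_def)
  have "\<exists>c. coloring (F - {s}) (om F) c \<and> c x = c y" if "s \<in> S'" for s
    using that S' xyS' mono by blast
  then obtain c' where c': "\<And>s. s \<in> S' \<Longrightarrow> coloring (F - {s}) (om F) (c' s) \<and> c' s x = c' s y"
    by metis
  \<comment> \<open>\<open>x\<close> and \<open>y\<close> lie outside \<open>S'\<close> and share a
    color in each \<open>c' s\<close>, so \<open>x\<close> stands in for the deleted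
    \<open>y\<close>.\<close>
  have "card S' * om F + 1 \<le> card (F - {y})"
  proof (rule minimp_card_lower[OF F S' \<open>S' \<noteq> {}\<close>, of c'])
    fix t assume "t \<in> F - (F - {y})"
    then show "\<exists>d\<in>F - {y}. t \<notin> S' \<and> d \<notin> S' \<and> (\<forall>s\<in>S'. c' s t = c' s d)"
      using xy xyS' c' by (intro bexI[of _ x]) auto
  qed (use c' in auto)
  also have "\<dots> < card F" using xy(2) fin by (rule card_Diff1_less[rotated])
  finally show False using upper mult_le_mono1[OF cardS', of "om F"] by simp
qed


section \<open>Forbidden induced subgraphs\<close>

text \<open>The adjacency pattern itself makes the five vertices distinct.\<close>

definition bull_free :: "'a set \<Rightarrow> bool" where
  "bull_free V \<longleftrightarrow> \<not> (\<exists>a\<in>V. \<exists>b\<in>V. \<exists>c\<in>V. \<exists>d\<in>V. \<exists>e\<in>V.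
     adj a b \<and> adj b c \<and> adj a c \<and> adj a d \<and> adj b e \<and>
     \<not> adj d b \<and> \<not> adj d c \<and> \<not> adj d e \<and> \<not> adj e a \<and> \<not> adj e c)"

definition P5_free :: "'a set \<Rightarrow> bool" where
  "P5_free V \<longleftrightarrow> \<not> (\<exists>p\<in>V. \<exists>q\<in>V. \<exists>r\<in>V. \<exists>s\<in>V. \<exists>t\<in>V.
     adj p q \<and> adj q r \<and> adj r s \<and> adj s t \<and>
     \<not> adj p r \<and> \<not> adj p s \<and> \<not> adj p t \<and> \<not> adj q s \<and> \<not> adj q t \<and> \<not> adj r t)"

definition no_odd_hole :: "'a set \<Rightarrow> bool" where
  "no_odd_hole V \<longleftrightarrow> \<not> (\<exists>k p. odd k \<and> 5 \<le> k \<and> inj_on p {..<k} \<and> p ` {..<k} \<subseteq> V \<and>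
     (\<forall>i<k. \<forall>j<k. adj (p i) (p j) \<longleftrightarrow> j = Suc i mod k \<or> i = Suc j mod k))"

lemma bull_freeD:
  assumes "bull_free V" "a \<in> V" "b \<in> V" "c \<in> V" "d \<in> V" "e \<in> V"
    "adj a b" "adj b c" "adj a c" "adj a d" "adj b e"
    "\<not> adj d b" "\<not> adj d c" "\<not> adj d e" "\<not> adj e a" "\<not> adj e c"
  shows False
  using assms unfolding bull_free_def by blast

lemma bull_free_subset: "bull_free V \<Longrightarrow> U \<subseteq> V \<Longrightarrow> bull_free U"
  unfolding bull_free_def by blast

lemma P5_free_subset: "P5_free V \<Longrightarrow> U \<subseteq> V \<Longrightarrow> P5_free U"
  unfolding P5_free_def by blast

lemma no_odd_hole_subset: "no_odd_hole V \<Longrightarrow> U \<subseteq> V \<Longrightarrow> no_odd_hole U"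
  unfolding no_odd_hole_def by (meson subset_trans)

section \<open>Kempe exchanges in the absence of odd holes\<close>

text \<open>
  A shortest bichromatic path between differently colored neighbors of \<open>q\<close> would close up
  through \<open>q\<close> to an odd hole.
\<close>

lemma no_bichromatic_path:
  assumes V: "no_odd_hole V" "Y \<subseteq> V" "q \<in> V" and st: "stable {x\<in>Y. adj q x}"
    and c: "coloring Y n c"
    and walk: "\<And>i. i < m \<Longrightarrow> p i \<in> Y \<and> p (Suc i) \<in> Y \<and> adj (p i) (p (Suc i))"
    and bi: "\<And>i. i \<le> m \<Longrightarrow> c (p i) \<in> {\<alpha>, \<beta>}"
    and ends: "adj q (p 0)" "adj q (p m)" "c (p 0) \<noteq> c (p m)"
  shows False
proof -
  define W where "W p m \<longleftrightarrow> (\<forall>i<m. p i \<in> Y \<and> p (Suc i) \<in> Y \<and> adj (p i) (p (Suc i))) \<and>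
    (\<forall>i\<le>m. c (p i) \<in> {\<alpha>, \<beta>}) \<and> adj q (p 0) \<and> adj q (p m) \<and> c (p 0) \<noteq> c (p m)"
    for p :: "nat \<Rightarrow> 'a" and m
  have "\<exists>m p. W p m" using assms unfolding W_def by blast
  then obtain m where "\<exists>p. W p m" and least: "\<And>l p. l < m \<Longrightarrow> \<not> W p l"
    by (subst (asm) exists_least_iff) blast
  then obtain p where p: "W p m" by blast
  have edge: "adj (p i) (p (Suc i))" if "i < m" for i using p that by (auto simp: W_def)
  have col: "c (p i) \<in> {\<alpha>, \<beta>}" if "i \<le> m" for i using p that by (auto simp: W_def)
  have ends: "adj q (p 0)" "adj q (p m)" "c (p 0) \<noteq> c (p m)" using p by (auto simp: W_def)
  then have m0: "0 < m" by (metis gr0I)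
  have Y: "p i \<in> Y" if "i \<le> m" for i
    using p m0 that unfolding W_def by (metis Suc_pred le_neq_implies_less lessI)
  have alt: "c (p (Suc i)) \<noteq> c (p i)" if "i < m" for i
    using c Y[of i] Y[of "Suc i"] edge[OF that] that unfolding coloring_def by fastforce
  have parity: "c (p i) = c (p 0) \<longleftrightarrow> even i" if "i \<le> m" for i
    using that
  proof (induction i)
    case (Suc i)
    then have "c (p i) \<in> {\<alpha>, \<beta>}" "c (p (Suc i)) \<in> {\<alpha>, \<beta>}" "c (p 0) \<in> {\<alpha>, \<beta>}"
        "c (p (Suc i)) \<noteq> c (p i)" "c (p i) = c (p 0) \<longleftrightarrow> even i"
      using alt[of i] col by simp_all
    then have "c (p (Suc i)) = c (p 0) \<longleftrightarrow> odd i" by (metis insertE singletonD)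
    then show ?case by simp
  qed simp
  \<comment> \<open>Colors alternate along the walk and differ at its ends, so the number of edges
    is odd.\<close>
  have "odd m" using parity[of m] ends by auto
  have "m \<noteq> 1"
    using st edge[of 0] ends Y[of 0] Y[of 1] by (auto simp: stable_def)
  then have m3: "3 \<le> m" using \<open>odd m\<close> m0 by presburger
  have chordless: "\<not> adj (p i) (p j)" if ij: "Suc i < j" "j \<le> m" for i j
  proof
    assume a: "adj (p i) (p j)"
    \<comment> \<open>The chord replaces the stretch from \<open>i\<close> to \<open>j\<close>; the
      ends are kept, so their colors still differ.\<close>
    define p' where "p' k = (if k \<le> i then p k else p (k + (j - Suc i)))" for k
    have "W p' (m - (j - Suc i))"
      unfolding W_def
    proof (intro conjI allI impI)
      fix k assume k: "k < m - (j - Suc i)"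
      show "p' k \<in> Y" "p' (Suc k) \<in> Y" using Y k ij by (auto simp: p'_def)
      consider "Suc k \<le> i" | "k = i" | "i < k" by linarith
      then show "adj (p' k) (p' (Suc k))"
        using a edge[of k] edge[of "k + (j - Suc i)"] k ij by cases (auto simp: p'_def)
    next
      fix k assume "k \<le> m - (j - Suc i)"
      then show "c (p' k) \<in> {\<alpha>, \<beta>}" using col[of k] col[of "k + (j - Suc i)"] ij by (auto simp: p'_def)
    qed (use ends ij in \<open>auto simp: p'_def\<close>)
    then show False using least ij by (metis diff_less zero_less_diff m0)
  qed
  \<comment> \<open>An inner neighbor of \<open>q\<close> differs in color from one of the ends and
    cuts off a shorter walk to it.\<close>
  have inner: "\<not> adj q (p i)" if i: "0 < i" "i < m" for i
  proof
    assume a: "adj q (p i)"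
    show False
    proof (cases "c (p i) = c (p 0)")
      case False
      then have "W p i" using p a i by (auto simp: W_def)
      then show False using least i by blast
    next
      case True
      then have "W (\<lambda>k. p (k + i)) (m - i)"
        using p a i by (auto simp: W_def)
      then show False using least[of "m - i"] i by simp
    qed
  qed
  \<comment> \<open>\<open>q\<close> may lie in \<open>Y\<close>; on the path, being adjacent to
    both ends, it would need a third color.\<close>
  have qp: "q \<noteq> p i" if i: "i \<le> m" for i
  proof
    assume q: "q = p i"
    then have "c q \<noteq> c (p 0)" "c q \<noteq> c (p m)"
      using ends c Y[OF i] Y[of 0] Y[of m] by (auto simp: coloring_def)
    then show False using ends(3) col[OF i] col[of 0] col[of m] q by auto
  qed
  \<comment> \<open>A repetition produces a chord: the first copy sees the successor of the second
    or, at the end of the path, the predecessor of the first sees the second.\<close>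
  have dist: "p i \<noteq> p j" if ij: "i < j" "j \<le> m" for i j
  proof
    assume eq: "p i = p j"
    show False
    proof (cases "j < m")
      case True
      then show False using chordless[of i "Suc j"] edge[of j] ij eq by auto
    next
      case False
      then have "j = m" using ij by simp
      moreover have "i \<noteq> 0" using ends eq \<open>j = m\<close> by metis
      ultimately show False using chordless[of "i - 1" j] edge[of "i - 1"] ij eq by (cases i) auto
    qed
  qed
  \<comment> \<open>\<open>q\<close> at index \<open>m + 1\<close> closes the path to a cycle of
    length \<open>m + 2\<close>, which is odd and at least 5.\<close>
  define h where "h i = (if i \<le> m then p i else q)" for i
  have key: "adj (h i) (h j) \<longleftrightarrow> j = Suc i mod (m + 2) \<or> i = Suc j mod (m + 2)"
    if ij: "i < j" "j < m + 2" for i j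
  proof (cases "j \<le> m")
    case True
    then show ?thesis using ij edge[of i] chordless[of i j]
      by (cases "Suc i = j") (auto simp: h_def)
  next
    case False
    then have j: "j = m + 1" using ij by simp
    consider "i = 0" | "0 < i" "i < m" | "i = m" using ij j by linarith
    then show ?thesis
    proof cases
      case 1 then show ?thesis using ends(1) j adj_sym by (auto simp: h_def)
    next
      case 2 then show ?thesis using inner[of i] j adj_sym by (auto simp: h_def)
    next
      case 3 then show ?thesis using ends(2) j adj_sym by (auto simp: h_def)
    qed
  qed
  have "adj (h i) (h j) \<longleftrightarrow> j = Suc i mod (m + 2) \<or> i = Suc j mod (m + 2)"
    if ij: "i < m + 2" "j < m + 2" for i j
  proof (cases i j rule: linorder_cases)
    case less then show ?thesis using key ij by blast
  next
    case equal then show ?thesis using ij by (auto simp: mod_Suc split: if_splits)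
  next
    case greater then show ?thesis using key[of j i] ij adj_sym by blast
  qed
  moreover have "inj_on h {..<m + 2}"
  proof (rule linorder_inj_onI')
    fix i j assume "i \<in> {..<m + 2}" "j \<in> {..<m + 2}" "i < j"
    then show "h i \<noteq> h j" using dist[of i j] qp[of i] by (auto simp: h_def)
  qed
  moreover have "h ` {..<m + 2} \<subseteq> V" using Y V by (auto simp: h_def)
  moreover have "odd (m + 2)" "5 \<le> m + 2" using \<open>odd m\<close> m3 by auto
  ultimately show False using V(1) unfolding no_odd_hole_def by blast
qed

text \<open>Kempe exchange: the two colors are swapped on the bichromatic component of
  \<open>x\<close>, which misses \<open>y\<close> by \<open>no_bichromatic_path\<close>.\<close>

lemma equalize_colors:
  assumes V: "no_odd_hole V" "Y \<subseteq> V" "q \<in> V" and st: "stable {x\<in>Y. adj q x}"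
    and xy: "x \<in> Y" "y \<in> Y" "adj q x" "adj q y" and c: "coloring Y n c"
  shows "\<exists>c'. coloring Y n c' \<and> c' x = c' y"
proof (cases "c x = c y")
  case False
  define \<alpha> \<beta> where "\<alpha> = c x" and "\<beta> = c y"
  define R where "R u v \<longleftrightarrow> u \<in> Y \<and> v \<in> Y \<and> adj u v \<and> c u \<in> {\<alpha>, \<beta>} \<and> c v \<in> {\<alpha>, \<beta>}" for u v
  define Z where "Z = {z. R\<^sup>*\<^sup>* x z}"
  have xZ: "x \<in> Z" by (simp add: Z_def)
  have Zc: "z \<in> Y \<and> c z \<in> {\<alpha>, \<beta>}" if "z \<in> Z" for z
    using that unfolding Z_def mem_Collect_eq
    by (induction rule: rtranclp_induct) (use xy \<alpha>_def R_def in auto)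
  have yZ: "y \<notin> Z"
  proof
    assume "y \<in> Z"
    then obtain m where "(R ^^ m) x y" unfolding Z_def by (auto dest: rtranclp_imp_relpowp)
    then obtain p where p: "p 0 = x" "p m = y" "\<And>i. i < m \<Longrightarrow> R (p i) (p (Suc i))"
      unfolding relpowp_fun_conv by blast
    have "c (p i) \<in> {\<alpha>, \<beta>}" if "i \<le> m" for i
      using p that by (cases "i = m") (auto simp: R_def \<beta>_def)
    then show False
      using no_bichromatic_path[OF V st c, of m p \<alpha> \<beta>] p xy False by (auto simp: R_def)
  qed
  define c' where "c' z = (if z \<in> Z then (if c z = \<alpha> then \<beta> else \<alpha>) else c z)" for z
  have step: "v \<in> Z" if "u \<in> Z" "v \<in> Y" "adj u v" "c v \<in> {\<alpha>, \<beta>}" for u v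
  proof -
    have "R u v" using that Zc[of u] by (auto simp: R_def)
    then show ?thesis using that(1) by (auto simp: Z_def)
  qed
  have "c' u < n" if "u \<in> Y" for u
    using that xy c by (auto simp: c'_def coloring_def \<alpha>_def \<beta>_def)
  moreover have "c' u \<noteq> c' v" if uv: "u \<in> Y" "v \<in> Y" "adj u v" for u v
  proof -
    have ne: "c u \<noteq> c v" using c uv by (auto simp: coloring_def)
    consider "u \<in> Z" "v \<in> Z" | "u \<in> Z" "v \<notin> Z" | "u \<notin> Z" "v \<in> Z" | "u \<notin> Z" "v \<notin> Z" by blast
    then show ?thesis
    proof cases
      case 1
      then show ?thesis using ne Zc[of u] Zc[of v] False by (auto simp: c'_def \<alpha>_def \<beta>_def)
    next
      case 2
      then have "c v \<notin> {\<alpha>, \<beta>}" using step[of u v] uv by blast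
      then show ?thesis using 2 by (auto simp: c'_def)
    next
      case 3
      then have "c u \<notin> {\<alpha>, \<beta>}" using step[of v u] uv adj_sym by blast
      then show ?thesis using 3 by (auto simp: c'_def)
    qed (use ne in \<open>simp add: c'_def\<close>)
  qed
  moreover have "c' x = c' y" using xZ yZ by (simp add: c'_def \<alpha>_def \<beta>_def)
  ultimately show ?thesis unfolding coloring_def by blast
qed (use c in blast)

text \<open>For every third vertex \<open>z\<close> a Kempe exchange gives \<open>x\<close> and
  \<open>y\<close> the same color in \<open>F - {z}\<close>, which
  \<open>minimp_no_monochromatic_pair\<close> excludes. The vertex \<open>q\<close> may lie in
  \<open>F\<close> or outside; both cases occur later.\<close>

lemma minimp_stable_nbhd_unique:
  assumes V: "no_odd_hole V" "F \<subseteq> V" "q \<in> V" and F: "minimp F" and st: "stable {x\<in>F. adj q x}"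
    and xy: "x \<in> F" "adj q x" "y \<in> F" "adj q y"
  shows "x = y"
proof (rule ccontr)
  assume "x \<noteq> y"
  moreover have "\<not> adj x y" using st xy by (auto simp: stable_def)
  moreover have "\<exists>c. coloring (F - {z}) (om F) c \<and> c x = c y"
    if z: "z \<in> F" "z \<noteq> x" "z \<noteq> y" for z
  proof -
    obtain c where c: "coloring (F - {z}) (om F) c"
      using minimp_coloring[OF F, of "F - {z}"] z by blast
    have "stable {x\<in>F - {z}. adj q x}" using st by (auto simp: stable_def)
    then show ?thesis
      using equalize_colors[of V "F - {z}" q x y, OF V(1) _ V(3) _ _ _ xy(2,4) c] V(2) xy z by auto
  qed
  ultimately show False using minimp_no_monochromatic_pair[OF F xy(1,3)] by blast
qed

text \<open>\<open>s\<close> has at most one neighbor in \<open>F\<close>, so one of the colors 0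
  and 1 is free for it.\<close>

lemma minimp_no_stable_nbhd:
  assumes V: "no_odd_hole V" "F \<subseteq> V" and F: "minimp F" and s: "s \<in> F"
    and st: "stable {x\<in>F. adj s x}"
  shows False
proof -
  obtain c where c: "coloring (F - {s}) (om F) c"
    using minimp_coloring[OF F, of "F - {s}"] s by blast
  have one: "x = y" if "x \<in> F" "adj s x" "y \<in> F" "adj s y" for x y
    using minimp_stable_nbhd_unique[OF V _ F st that] s V by blast
  obtain i where i: "i < om F" "\<And>x. x \<in> F \<Longrightarrow> adj s x \<Longrightarrow> c x \<noteq> i"
  proof (cases "\<exists>x\<in>F. adj s x \<and> c x = 0")
    case True
    then have "c x \<noteq> 1" if "x \<in> F" "adj s x" for x using one that by fastforce
    then show ?thesis using that[of 1] minimp_om[OF F] by simp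
  next
    case False
    then show ?thesis using that[of 0] minimp_om[OF F] by fastforce
  qed
  have "coloring F (om F) (c(s := i))"
    using c i adj_sym unfolding coloring_def by (auto dest: adj_sym)
  then show False using F by (auto simp: minimp_def colorable_def)
qed


section \<open>Anticenters\<close>

text \<open>
  Let \<open>A\<close> be the set of vertices anticomplete to \<open>C\<close> and \<open>B\<close> the set of their neighbors
  outside \<open>A\<close>. If no vertex of \<open>B\<close> were mixed on \<open>C\<close>, then a maximal connected superset
  of \<open>C\<close> that is anticomplete to \<open>A\<close> and complete to \<open>B\<close> would be homogeneous.
\<close>

lemma mixed_attachment:
  assumes fin: "finite V" and bull: "bull_free V" and prime: "\<And>X. \<not> homogeneous X V"
    and C: "C \<subseteq> V" "conn C" "2 \<le> card C"
    and v: "v \<in> V" "v \<notin> C" "\<forall>x\<in>C. \<not> adj v x"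
  obtains w u x y where "w \<in> V" "\<forall>x\<in>C. \<not> adj w x" "u \<in> V" "adj u w"
    "x \<in> C" "adj u x" "y \<in> C" "\<not> adj u y"
proof -
  define A where "A = {w\<in>V - C. \<forall>x\<in>C. \<not> adj w x}"
  define B where "B = {u\<in>V - A. \<exists>w\<in>A. adj u w}"
  have "\<exists>u\<in>B. \<exists>y\<in>C. \<not> adj u y"
  proof (rule ccontr)
    assume "\<not> ?thesis"
    then have BC: "\<And>u x. u \<in> B \<Longrightarrow> x \<in> C \<Longrightarrow> adj u x" by blast
    define P where "P = {X. C \<subseteq> X \<and> X \<subseteq> V \<and> conn X \<and> X \<inter> A = {} \<and> (\<forall>a\<in>A. \<forall>x\<in>X. \<not> adj a x) \<and>
      (\<forall>b\<in>B. \<forall>x\<in>X. adj b x)}"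
    have "P \<subseteq> Pow V" by (auto simp: P_def)
    then have "finite P" using fin finite_subset by blast
    moreover have "C \<in> P" using C BC by (auto simp: A_def P_def)
    ultimately obtain X where "X \<in> P" and max: "\<forall>Y\<in>P. X \<subseteq> Y \<longrightarrow> X = Y"
      using finite_has_maximal2[of P C] by blast
    then have X: "C \<subseteq> X" "X \<subseteq> V" "conn X" "X \<inter> A = {}"
        "\<And>a x. a \<in> A \<Longrightarrow> x \<in> X \<Longrightarrow> \<not> adj a x" "\<And>b x. b \<in> B \<Longrightarrow> x \<in> X \<Longrightarrow> adj b x"
      by (auto simp: P_def)
    have vA: "v \<in> A" using v by (auto simp: A_def)
    have "homogeneous X V"
      unfolding homogeneous_def
    proof (intro conjI ballI)
      show XV: "X \<subseteq> V" by fact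
      show "X \<noteq> V" using X(4) vA v(1) by blast
      show "2 \<le> card X" using X(1) C(3) card_mono[OF finite_subset[OF XV fin], of C] by simp
      fix y assume y: "y \<in> V - X"
      show "(\<forall>x\<in>X. adj y x) \<or> (\<forall>x\<in>X. \<not> adj y x)"
      proof (rule ccontr)
        assume "\<not> ?thesis"
        then obtain p q where pq: "p \<in> X" "adj y p" "q \<in> X" "\<not> adj y q" by blast
        \<comment> \<open>\<open>y\<close> has a neighbor and a nonneighbor in \<open>X\<close>,
          whereas \<open>A\<close> is anticomplete and \<open>B\<close> complete to
          \<open>X\<close>.\<close>
        have yA: "y \<notin> A" and yB: "y \<notin> B" using X(5,6) pq by blast+
        have ya: "\<not> adj a y" if "a \<in> A" for a
          using that yA yB y adj_sym by (auto simp: B_def)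
        \<comment> \<open>Otherwise the triangle \<open>b\<close>, \<open>x\<close>,
          \<open>z\<close> with pendant edges from \<open>b\<close> to \<open>w\<close> and from
          \<open>x\<close> to \<open>y\<close> is a bull, for an edge \<open>xz\<close> of
          \<open>X\<close> on which \<open>y\<close> is mixed.\<close>
        have yb: "adj b y" if b: "b \<in> B" for b
        proof (rule ccontr)
          assume nb: "\<not> adj b y"
          obtain w where w: "w \<in> A" "adj b w" "b \<in> V" using b by (auto simp: B_def)
          obtain x z where xz: "x \<in> X" "z \<in> X" "adj x z" "adj y x" "\<not> adj y z"
            using conn_mixed_edge[OF X(3) pq] by blast
          have "adj b x" "adj b z" using X(6) b xz by blast+
          moreover have "\<not> adj w x" "\<not> adj w z" "\<not> adj w y" "w \<in> V"
            using X(5) w(1) xz(1,2) ya by (auto simp: A_def)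
          moreover have "x \<in> V" "z \<in> V" "y \<in> V" using xz XV y by auto
          ultimately show False
            using bull_freeD[OF bull, of b x z w y] w xz nb adj_sym by blast
        qed
        have "insert y X \<in> P"
          using X y yA ya yb conn_insert[OF X(3) pq(1,2)] unfolding P_def by auto
        then have "X = insert y X" using max by blast
        then show False using y by blast
      qed
    qed
    then show False using prime by blast
  qed
  then obtain u y w where u: "u \<in> V" "u \<notin> A" "w \<in> A" "adj u w" "y \<in> C" "\<not> adj u y"
    by (auto simp: B_def)
  \<comment> \<open>Being adjacent to \<open>w\<close>, the vertex \<open>u\<close> is outside
    \<open>C\<close>; being also outside \<open>A\<close>, it has a neighbor in
    \<open>C\<close>.\<close>
  moreover have "u \<notin> C" using u adj_sym by (auto simp: A_def)
  ultimately obtain x where "x \<in> C" "adj u x" by (auto simp: A_def)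
  then show ?thesis using that[of w u x y] u by (auto simp: A_def)
qed

text \<open>
  The components of the neighborhood of the attachment \<open>u\<close> in \<open>F\<close> are homogeneous in \<open>F\<close>,
  hence trivial.
\<close>

lemma minimp_stable_attachment:
  assumes fin: "finite V" and bull: "bull_free V" and prime: "\<And>X. \<not> homogeneous X V"
    and F: "minimp F" "F \<subseteq> V" and v: "v \<in> V" "v \<notin> F" "\<forall>x\<in>F. \<not> adj v x"
  obtains w u x where "w \<in> V" "\<forall>x\<in>F. \<not> adj w x" "u \<in> V" "adj u w"
    "x \<in> F" "adj u x" "stable {x\<in>F. adj u x}"
proof -
  obtain w u x y where w: "w \<in> V" "\<forall>x\<in>F. \<not> adj w x" "u \<in> V" "adj u w"
      and x: "x \<in> F" "adj u x" and y: "y \<in> F" "\<not> adj u y"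
    using mixed_attachment[OF fin bull prime F(2) minimp_conn[OF F(1)] minimp_card[OF F(1)] v]
    by blast
  have "stable {x\<in>F. adj u x}"
    unfolding stable_def
  proof (intro ballI notI)
    fix a b assume ab: "a \<in> {x\<in>F. adj u x}" "b \<in> {x\<in>F. adj u x}" "adj a b"
    show False
    proof (rule minimp_no_component[OF F(1) _ ab])
      show "{x\<in>F. adj u x} \<subset> F" using y by blast
      fix p q r assume *: "q \<in> F - {x\<in>F. adj u x}" "p \<in> {x\<in>F. adj u x}" "r \<in> {x\<in>F. adj u x}"
        "adj p r" "adj q p"
      then have "u \<in> V" "p \<in> V" "r \<in> V" "q \<in> V" "adj u p" "adj u r" "adj p q" "\<not> adj q u"
        "\<not> adj w p" "\<not> adj w r" "\<not> adj w q"
        using w F(2) adj_sym by auto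
      \<comment> \<open>Otherwise the triangle \<open>u\<close>, \<open>p\<close>, \<open>r\<close>
        with pendants \<open>w\<close> at \<open>u\<close> and \<open>q\<close> at \<open>p\<close>
        is a bull.\<close>
      then show "adj q r"
        using bull_freeD[OF bull, of u p r w q] w(1,4) \<open>adj p r\<close> by blast
    qed
  qed
  then show ?thesis using that w x by blast
qed

text \<open>Once \<open>s\<close> is the only neighbor of \<open>u\<close> in \<open>F\<close>, the
  vertex \<open>u\<close> does for the neighborhood of \<open>s\<close> what \<open>w\<close> did
  for that of \<open>u\<close>: a triangle \<open>s\<close>, \<open>p\<close>, \<open>r\<close> with
  pendants \<open>u\<close> and \<open>q\<close> is excluded, and the neighborhood is stable
  too.\<close>

lemma no_minimp_with_anticenter_odd_hole_free:
  assumes fin: "finite V" and bull: "bull_free V" and prime: "\<And>X. \<not> homogeneous X V"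
    and odd: "no_odd_hole V"
    and F: "minimp F" "F \<subseteq> V" and v: "v \<in> V" "v \<notin> F" "\<forall>x\<in>F. \<not> adj v x"
  shows False
proof -
  obtain w u s where w: "w \<in> V" "\<forall>x\<in>F. \<not> adj w x" "u \<in> V" "adj u w"
      and s: "s \<in> F" "adj u s" and st: "stable {x\<in>F. adj u x}"
    using minimp_stable_attachment[OF fin bull prime F v] by blast
  have only: "\<not> adj u x" if "x \<in> F" "x \<noteq> s" for x
    using minimp_stable_nbhd_unique[OF odd F(2) w(3) F(1) st] that s by blast
  have "stable {x\<in>F. adj s x}"
    unfolding stable_def
  proof (intro ballI notI)
    fix a b assume ab: "a \<in> {x\<in>F. adj s x}" "b \<in> {x\<in>F. adj s x}" "adj a b"
    show False
    proof (rule minimp_no_component[OF F(1) _ ab])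
      show "{x\<in>F. adj s x} \<subset> F" using s(1) adj_irrefl by blast
      fix p q r assume *: "q \<in> F - {x\<in>F. adj s x}" "p \<in> {x\<in>F. adj s x}" "r \<in> {x\<in>F. adj s x}"
        "adj p r" "adj q p"
      show "adj q r"
      proof (cases "q = s")
        case False
        have "p \<noteq> s" "r \<noteq> s" using * by auto
        then have "s \<in> V" "p \<in> V" "r \<in> V" "q \<in> V" "adj s p" "adj s r" "adj p q" "\<not> adj q s"
          "\<not> adj u p" "\<not> adj u r" "\<not> adj u q" "adj s u"
          using F(2) s * only False adj_sym by auto
        then show ?thesis
          using bull_freeD[OF bull, of s p r u q] w(3) \<open>adj p r\<close> by blast
      qed (use * in auto)
    qed
  qed
  then show False using minimp_no_stable_nbhd[OF odd F(2,1) s(1)] by blast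
qed

text \<open>The forbidden path \<open>w\<close>, \<open>u\<close>, \<open>q\<close>,
  \<open>p\<close>, \<open>r\<close> keeps a vertex \<open>q\<close> of \<open>F - T\<close> from
  separating an edge \<open>pr\<close> of \<open>T\<close>, so both \<open>T\<close> and
  \<open>F - T\<close> are stable and two colors suffice for \<open>F\<close>.\<close>

lemma no_minimp_with_anticenter_P5_free:
  assumes fin: "finite V" and bull: "bull_free V" and prime: "\<And>X. \<not> homogeneous X V"
    and P5: "P5_free V"
    and F: "minimp F" "F \<subseteq> V" and v: "v \<in> V" "v \<notin> F" "\<forall>x\<in>F. \<not> adj v x"
  shows False
proof -
  obtain w u s where w: "w \<in> V" "\<forall>x\<in>F. \<not> adj w x" "u \<in> V" "adj u w"
      and s: "s \<in> F" "adj u s" and st: "stable {x\<in>F. adj u x}"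
    using minimp_stable_attachment[OF fin bull prime F v] by blast
  define T where "T = {x\<in>F. \<not> adj u x}"
  have "stable T"
    unfolding stable_def
  proof (intro ballI notI)
    fix a b assume ab: "a \<in> T" "b \<in> T" "adj a b"
    show False
    proof (rule minimp_no_component[OF F(1) _ ab])
      show "T \<subset> F" using s by (auto simp: T_def)
      fix p q r assume *: "q \<in> F - T" "p \<in> T" "r \<in> T" "adj p r" "adj q p"
      then have "p \<in> V" "r \<in> V" "q \<in> V" "adj u q" "\<not> adj u p" "\<not> adj u r"
        "\<not> adj w p" "\<not> adj w r" "\<not> adj w q" "adj w u"
        using w F(2) adj_sym by (auto simp: T_def)
      then show "adj q r"
        using P5 w(1,3) \<open>adj p r\<close> \<open>adj q p\<close> unfolding P5_free_def by blast
    qed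
  qed
  then have "coloring F 2 (\<lambda>x. if x \<in> T then 0 else 1)"
    using st by (auto simp: coloring_def stable_def T_def)
  then have "colorable F (om F)"
    using minimp_om[OF F(1)] colorable_mono colorable_def by blast
  then show False using F(1) by (simp add: minimp_def)
qed


section \<open>Weight division\<close>

text \<open>\<open>v\<close> itself belongs to this set but is isolated in it. A minimal imperfect
  subset is connected with at least two vertices, so it misses \<open>v\<close> and is anticomplete
  to it.\<close>

lemma perf_nonneighbors:
  assumes "finite V" "bull_free V" "no_odd_hole V \<or> P5_free V" "\<And>X. \<not> homogeneous X V" "v \<in> V"
  shows "perf {x\<in>V. \<not> adj v x}"
proof (rule ccontr)
  assume "\<not> ?thesis"
  then obtain F where F: "F \<subseteq> {x\<in>V. \<not> adj v x}" "minimp F"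
    using not_perf_obtains_minimp[of "{x\<in>V. \<not> adj v x}"] assms(1) by auto
  have "v \<notin> F"
  proof
    assume "v \<in> F"
    moreover have "{v} \<noteq> F" using minimp_card[OF F(2)] by auto
    ultimately obtain y where "y \<in> F" "adj v y"
      using minimp_conn[OF F(2)] unfolding conn_def
      by (metis Diff_iff empty_not_insert empty_subsetI insert_subset singletonD)
    then show False using F(1) by blast
  qed
  moreover have "F \<subseteq> V" "\<forall>x\<in>F. \<not> adj v x" using F(1) by auto
  ultimately show False
    using no_minimp_with_anticenter_odd_hole_free[of V F v] no_minimp_with_anticenter_P5_free[of V F v] assms F(2)
    by blast
qed

section \<open>Substitution of perfect sets\<close>

lemma colorable_swap_twin:
  assumes fin: "finite Q" and xp: "x \<notin> Q" "p \<notin> Q" and twin: "\<And>y. y \<in> Q \<Longrightarrow> adj y p \<longleftrightarrow> adj y x"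
    and col: "colorable (insert x Q) (om (insert x Q))"
  shows "colorable (insert p Q) (om (insert p Q))"
proof -
  obtain c where c: "coloring (insert x Q) (om (insert x Q)) c" using col colorable_def by blast
  have twin': "adj p y \<longleftrightarrow> adj x y" if "y \<in> Q" for y using twin[OF that] adj_sym by blast
  have "coloring (insert p Q) (om (insert x Q)) (c(p := c x))"
    using c xp twin twin' by (auto simp: coloring_def)
  moreover have "om (insert x Q) \<le> om (insert p Q)"
  proof -
    obtain K where K: "K \<subseteq> insert x Q" "clq K" "card K = om (insert x Q)"
      using om_attained[of "insert x Q"] fin by blast
    have finK: "finite K" using K(1) fin finite_subset by blast
    show ?thesis
    proof (cases "x \<in> K")
      case True
      have KQ: "K - {x} \<subseteq> Q" using K by auto
      have "clq (insert p (K - {x}))"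
        using K True twin twin' KQ unfolding clq_def by (auto; blast)
      moreover have "card (insert p (K - {x})) = card K"
        using KQ xp True finK card_Suc_Diff1[OF finK True]
        by (subst card_insert_disjoint) auto
      ultimately show ?thesis
        using om_ge[of "insert p Q" "insert p (K - {x})"] KQ K fin by auto
    next
      case False
      then show ?thesis using om_ge[of "insert p Q" K] K fin by auto
    qed
  qed
  ultimately show ?thesis using coloring_mono colorable_def by blast
qed

text \<open>A minimal imperfect set in the union does not lie in \<open>X\<close>, and its trace on
  \<open>X\<close> would be homogeneous if it had two elements. With at most one, the set is
  contained in \<open>P1\<close>, up to exchanging that element for its twin
  \<open>x\<close>.\<close>

lemma perf_substitute:
  assumes fin: "finite V" and X: "X \<subseteq> V"
    and hom: "\<And>y. y \<in> V - X \<Longrightarrow> (\<forall>x\<in>X. adj y x) \<or> (\<forall>x\<in>X. \<not> adj y x)"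
    and x: "x \<in> X" and P1: "x \<in> P1" "P1 \<subseteq> insert x (V - X)" "perf P1"
    and P2: "P2 \<subseteq> X" "perf P2"
  shows "perf ((P1 - {x}) \<union> P2)"
proof (rule ccontr)
  assume "\<not> ?thesis"
  moreover have "finite ((P1 - {x}) \<union> P2)" using fin P1 P2 X by (auto intro: finite_subset)
  ultimately obtain F where F: "F \<subseteq> (P1 - {x}) \<union> P2" "minimp F"
    using not_perf_obtains_minimp by metis
  have finF: "finite F" using F by (simp add: minimp_def)
  have FV: "F - X \<subseteq> V - X" and FX: "F \<inter> X \<subseteq> P2" and FP: "F - X \<subseteq> P1 - {x}"
    using F(1) P1 P2 by auto
  have ne: "F \<inter> X \<noteq> F" using FX perf_no_minimp[OF P2(2), of F] F(2) by auto
  consider "2 \<le> card (F \<inter> X)" | "F \<inter> X = {}" | p where "F \<inter> X = {p}"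
  proof -
    have "card (F \<inter> X) = 0 \<or> card (F \<inter> X) = 1 \<or> 2 \<le> card (F \<inter> X)" by linarith
    then show ?thesis using that finF by (auto simp: card_1_singleton_iff)
  qed
  then show False
  proof cases
    case 1
    then have "homogeneous (F \<inter> X) F"
      using ne hom FV unfolding homogeneous_def by blast
    then show False using minimp_not_homogeneous F(2) by blast
  next
    case 2
    then have "F \<subseteq> P1" using FP by blast
    then show False using perf_no_minimp[OF P1(3)] F(2) by blast
  next
    case (3 p)
    then have p: "p \<in> X" "F = insert p (F - X)" by auto
    have "insert x (F - X) \<subseteq> P1" using FP P1(1) by auto
    then have "colorable (insert x (F - X)) (om (insert x (F - X)))" using P1(3) by (auto simp: perf_def)
    moreover have "adj y p \<longleftrightarrow> adj y x" if "y \<in> F - X" for y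
      using hom[of y] FV that p(1) x by blast
    ultimately have "colorable (insert p (F - X)) (om (insert p (F - X)))"
      using colorable_swap_twin[of "F - X" x p] finF x p(1) by blast
    then show False using F(2) p(2) by (simp add: minimp_def)
  qed
qed

section \<open>Clique weights under contraction\<close>

lemma wom_less:
  assumes "finite X" "\<And>K. K \<subseteq> X \<Longrightarrow> clq K \<Longrightarrow> sum w K < m"
  shows "wom w X < m"
  using wom_attained[OF assms(1), of w] assms(2) by metis

lemma wom_mono: "finite Y \<Longrightarrow> X \<subseteq> Y \<Longrightarrow> wom w X \<le> wom w Y"
  by (metis finite_subset wom_attained wom_ge subset_trans)

definition divides_weight :: "('a \<Rightarrow> nat) \<Rightarrow> 'a set \<Rightarrow> 'a set \<Rightarrow> 'a set \<Rightarrow> bool" where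
  "divides_weight w V P W \<longleftrightarrow> P \<union> W = V \<and> P \<inter> W = {} \<and> perf P \<and> wom w W < wom w V"

text \<open>
  The contraction of \<open>X\<close> to a vertex is realized inside \<open>V\<close>: a vertex \<open>x\<close> of \<open>X\<close> is kept
  and receives the maximum clique weight of \<open>X\<close>.
\<close>

lemma divides_weight_homogeneous:
  assumes fin: "finite V" and X: "X \<subseteq> V" and x: "x \<in> X"
    and hom: "\<And>y. y \<in> V - X \<Longrightarrow> (\<forall>x\<in>X. adj y x) \<or> (\<forall>x\<in>X. \<not> adj y x)"
    and 1: "divides_weight (w(x := wom w X)) (insert x (V - X)) P1 W1"
    and 2: "divides_weight w X P2 W2"
  shows "\<exists>P W. divides_weight w V P W"
proof -
  define w' where "w' = w(x := wom w X)"
  define V' where "V' = insert x (V - X)"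
  have P1: "P1 \<union> W1 = V'" "P1 \<inter> W1 = {}" "perf P1" "wom w' W1 < wom w' V'"
    using 1 by (auto simp: divides_weight_def w'_def V'_def)
  have P2: "P2 \<union> W2 = X" "P2 \<inter> W2 = {}" "perf P2" "wom w W2 < wom w X"
    using 2 by (auto simp: divides_weight_def)
  have finX: "finite X" using fin X finite_subset by blast
  have finV': "finite V'" using fin by (simp add: V'_def)
  have fin12: "finite W1" "finite W2" using P1(1) P2(1) finV' finX by (metis finite_Un)+
  have same: "sum w' K = sum w K" if "x \<notin> K" for K
    using that by (intro sum.cong) (auto simp: w'_def)
  have contracted: "sum w' (insert x K) = wom w X + sum w K" if "K \<subseteq> V - X" for K
  proof -
    have "x \<notin> K" "finite K" using that x fin by (auto intro: finite_subset)
    then show ?thesis using same[of K] by (simp add: w'_def)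
  qed
  have split: "sum w K = sum w (K \<inter> X) + sum w (K - X)" if "K \<subseteq> V" for K
  proof -
    have "finite K" using that fin finite_subset by blast
    then show ?thesis by (metis sum.Int_Diff)
  qed
  have complete: "adj y z" if K: "clq K" "K \<subseteq> V" "K \<inter> X \<noteq> {}" "y \<in> K - X" "z \<in> X" for K y z
  proof -
    obtain k where k: "k \<in> K" "k \<in> X" using K(3) by blast
    then have "adj y k" using K(1,4) unfolding clq_def by (metis DiffD1 DiffD2)
    then show ?thesis using hom[of y] k K by blast
  qed
  have contract_clq: "clq (insert x (K - X))" if "clq K" "K \<subseteq> V" "K \<inter> X \<noteq> {}" for K
    using complete[OF that _ x] that(1) adj_sym unfolding clq_def by blast
  \<comment> \<open>A clique through \<open>x\<close> is blown up to a clique of \<open>V\<close> of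
    equal weight by replacing \<open>x\<close> with a heaviest clique of \<open>X\<close>.\<close>
  have le: "wom w' V' \<le> wom w V"
  proof -
    obtain K where K: "K \<subseteq> V'" "clq K" "sum w' K = wom w' V'" using wom_attained[OF finV'] by blast
    show ?thesis
    proof (cases "x \<in> K")
      case False
      then have "K \<subseteq> V" "sum w K = wom w' V'" using K same by (auto simp: V'_def)
      then show ?thesis using wom_ge[OF fin _ K(2), of w] by simp
    next
      case True
      obtain L where L: "L \<subseteq> X" "clq L" "sum w L = wom w X" using wom_attained[OF finX] by blast
      define Q where "Q = K - {x}"
      have Q: "Q \<subseteq> V - X" "K = insert x Q" "clq Q"
        using K True clq_subset[OF K(2), of Q] by (auto simp: Q_def V'_def)
      have Qx: "adj y z" if "y \<in> Q" "z \<in> X" for y z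
        using hom[of y] Q(1) that K(2) True x unfolding Q_def clq_def by blast
      have clq: "clq (L \<union> Q)"
        using L(2) Q(3) Qx L(1) adj_sym unfolding clq_def by blast
      have sub: "L \<union> Q \<subseteq> V" using L Q X by blast
      have "(L \<union> Q) \<inter> X = L" "(L \<union> Q) - X = Q" using L Q by auto
      then have "sum w (L \<union> Q) = wom w' V'"
        using split[OF sub] L(3) contracted[OF Q(1)] K(3) Q(2) by simp
      then show ?thesis using wom_ge[OF fin sub clq, of w] by simp
    qed
  qed
  show ?thesis
  proof (cases "x \<in> P1")
    case True
    \<comment> \<open>When \<open>x\<close> lies in \<open>P1\<close>, it is replaced by
      \<open>P2\<close>. Contracting a clique of \<open>W1 \<union> W2\<close> that meets
      \<open>X\<close> makes it strictly heavier, because every clique of \<open>W2\<close> weighs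
      less than \<open>wom w X\<close>.\<close>
    have "divides_weight w V ((P1 - {x}) \<union> P2) (W1 \<union> W2)"
      unfolding divides_weight_def
    proof (intro conjI)
      have xW: "x \<notin> W1" using True P1(2) by blast
      then have W1: "W1 \<subseteq> V - X" using P1(1) by (auto simp: V'_def)
      show "P1 - {x} \<union> P2 \<union> (W1 \<union> W2) = V"
        using P1(1) P2(1) True X x xW by (auto simp: V'_def)
      show "(P1 - {x} \<union> P2) \<inter> (W1 \<union> W2) = {}"
        using P1(1,2) P2(1,2) xW by (auto simp: V'_def)
      show "perf (P1 - {x} \<union> P2)"
        using perf_substitute[OF fin X hom x True _ P1(3) _ P2(3)] P1(1) P2(1)
        by (auto simp: V'_def)
      show "wom w (W1 \<union> W2) < wom w V"
      proof (rule wom_less)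
        show "finite (W1 \<union> W2)" using fin12 by simp
        fix K assume K: "K \<subseteq> W1 \<union> W2" "clq K"
        have KV: "K \<subseteq> V" using K(1) W1 P2(1) X by blast
        show "sum w K < wom w V"
        proof (cases "K \<inter> X = {}")
          case True
          then have "K \<subseteq> W1" "x \<notin> K" using K(1) P2(1) x by auto
          then show ?thesis
            using wom_ge[OF fin12(1) _ K(2), of w'] same P1(4) le by fastforce
        next
          case False
          have "K \<inter> X \<subseteq> W2" using K(1) W1 by blast
          then have "sum w (K \<inter> X) < wom w X"
            using wom_ge[OF fin12(2) _ clq_subset[OF K(2)], of "K \<inter> X" w] P2(4) by fastforce
          then have "sum w K < sum w' (insert x (K - X))"
            using split[OF KV] contracted[of "K - X"] KV by fastforce
          also have "\<dots> \<le> wom w' V'"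
            using KV by (intro wom_ge[OF finV' _ contract_clq[OF K(2) KV False]]) (auto simp: V'_def)
          finally show ?thesis using le by simp
        qed
      qed
    qed
    then show ?thesis by blast
  next
    case False
    then have xW: "x \<in> W1" using P1(1) by (auto simp: V'_def)
    \<comment> \<open>When \<open>x\<close> lies in \<open>W1\<close>, all of \<open>X\<close> joins
      it. Contracting a clique that meets \<open>X\<close> loses no weight and leads into
      \<open>W1\<close>, whose bound is strict.\<close>
    have "divides_weight w V P1 (W1 \<union> X)"
      unfolding divides_weight_def
    proof (intro conjI)
      show "P1 \<union> (W1 \<union> X) = V" using P1(1) X x by (auto simp: V'_def)
      show "P1 \<inter> (W1 \<union> X) = {}" using P1(1,2) False by (auto simp: V'_def)
      show "wom w (W1 \<union> X) < wom w V"
      proof (rule wom_less)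
        show "finite (W1 \<union> X)" using fin12 finX by simp
        fix K assume K: "K \<subseteq> W1 \<union> X" "clq K"
        have "W1 \<subseteq> insert x (V - X)" using P1(1) unfolding V'_def by blast
        then have KV: "K \<subseteq> V" using K(1) X x by blast
        show "sum w K < wom w V"
        proof (cases "K \<inter> X = {}")
          case True
          then have "K \<subseteq> W1" "x \<notin> K" using K(1) x by auto
          then show ?thesis
            using wom_ge[OF fin12(1) _ K(2), of w'] same P1(4) le by fastforce
        next
          case False
          have "sum w (K \<inter> X) \<le> wom w X"
            using wom_ge[OF finX _ clq_subset[OF K(2)], of "K \<inter> X" w] by blast
          then have "sum w K \<le> sum w' (insert x (K - X))"
            using split[OF KV] contracted[of "K - X"] KV by fastforce
          also have "\<dots> \<le> wom w' W1"
            using K(1) xW by (intro wom_ge[OF fin12(1) _ contract_clq[OF K(2) KV False]]) auto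
          finally show ?thesis using le P1(4) by simp
        qed
      qed
    qed (rule P1(3))
    then show ?thesis by blast
  qed
qed

text \<open>The induction runs over all weights at once, since contraction changes them.\<close>

lemma weight_division:
  assumes "finite V" "bull_free V" "no_odd_hole V \<or> P5_free V" "\<exists>v\<in>V. w v \<noteq> 0"
  shows "\<exists>P W. divides_weight w V P W"
  using assms
proof (induction "card V" arbitrary: V w rule: less_induct)
  case less
  note fin = less.prems(1)
  have IH: "\<exists>P W. divides_weight w' U P W" if "U \<subset> V" "\<exists>v\<in>U. w' v \<noteq> 0" for U w'
    using less.hyps[of U w'] that less.prems psubset_card_mono[OF fin]
      bull_free_subset no_odd_hole_subset P5_free_subset finite_subset
    by (meson psubset_imp_subset)
  \<comment> \<open>Zero weights come first: in the second case, positivity keeps the weights on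
    \<open>X\<close> and on the contraction from vanishing identically.\<close>
  consider z where "z \<in> V" "w z = 0"
    | X where "homogeneous X V" "\<And>z. z \<in> V \<Longrightarrow> w z \<noteq> 0"
    | "\<And>X. \<not> homogeneous X V" by blast
  then show ?case
  proof cases
    case (1 z)
    have "\<exists>v\<in>V - {z}. w v \<noteq> 0" using less.prems(4) 1 by auto
    then obtain P W where PW: "divides_weight w (V - {z}) P W" using IH[of "V - {z}" w] 1 by blast
    have "W \<subseteq> V" using PW by (auto simp: divides_weight_def)
    then have finW: "finite (insert z W)" using fin finite_subset by blast
    have "wom w (insert z W) < wom w V"
    proof (rule wom_less[OF finW])
      fix K assume K: "K \<subseteq> insert z W" "clq K"
      have "sum w K = sum w (K - {z})"
        using 1 finite_subset[OF K(1) finW] by (cases "z \<in> K") (auto simp: sum.remove)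
      also have "\<dots> \<le> wom w W"
        using K finW by (intro wom_ge clq_subset[OF K(2)]) auto
      also have "\<dots> < wom w (V - {z})" using PW by (simp add: divides_weight_def)
      also have "\<dots> \<le> wom w V" using fin by (intro wom_mono) auto
      finally show "sum w K < wom w V" .
    qed
    then have "divides_weight w V P (insert z W)" using PW 1 by (auto simp: divides_weight_def)
    then show ?thesis by blast
  next
    case (2 X)
    have X: "X \<subseteq> V" "X \<noteq> V" "2 \<le> card X"
        "\<And>y. y \<in> V - X \<Longrightarrow> (\<forall>x\<in>X. adj y x) \<or> (\<forall>x\<in>X. \<not> adj y x)"
      using 2(1) by (auto simp: homogeneous_def)
    obtain x where x: "x \<in> X" using X(3) by fastforce
    have "X \<noteq> {x}" using X(3) by auto
    then have ps: "insert x (V - X) \<subset> V" using X(1) x by blast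
    have finX: "finite X" using X(1) fin finite_subset by blast
    have "w x \<le> wom w X" using wom_ge[OF finX, of "{x}" w] x by (simp add: clq_def)
    then have "\<exists>v\<in>insert x (V - X). (w(x := wom w X)) v \<noteq> 0" using 2(2)[of x] x X(1) by auto
    then obtain P1 W1 where "divides_weight (w(x := wom w X)) (insert x (V - X)) P1 W1"
      using IH[OF ps] by blast
    moreover obtain P2 W2 where "divides_weight w X P2 W2"
      using IH[of X w] X(1,2) x 2(2) by blast
    ultimately show ?thesis using divides_weight_homogeneous[OF fin X(1) x X(4)] by blast
  next
    case 3
    obtain v where v: "v \<in> V" "w v \<noteq> 0" using less.prems(4) by blast
    have "wom w {x\<in>V. adj v x} < wom w V"
    proof (rule wom_less)
      fix K assume K: "K \<subseteq> {x\<in>V. adj v x}" "clq K"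
      have "clq (insert v K)" using K adj_sym unfolding clq_def by blast
      then have "sum w (insert v K) \<le> wom w V" using K v fin by (intro wom_ge) auto
      moreover have "v \<notin> K" "finite K" using K fin by (auto intro: finite_subset)
      ultimately show "sum w K < wom w V" using v(2) by simp
    qed (use fin in auto)
    then have "divides_weight w V {x\<in>V. \<not> adj v x} {x\<in>V. adj v x}"
      using perf_nonneighbors[OF less.prems(1-3) 3 v(1)] by (auto simp: divides_weight_def)
    then show ?thesis by blast
  qed
qed

end


section \<open>Graphs\<close>

locale finite_graph =
  fixes G :: "'a sgraph"
  assumes G: "finite_simple_graph G"
begin

section \<open>Translation between graphs and adjacency relations\<close>

sublocale adjacency "\<lambda>u v. {u, v} \<in> edges G"
proof
  show "{x, x} \<notin> edges G" for x
    using G by (auto simp: finite_simple_graph_def nsets_def)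
qed (simp add: insert_commute)

lemma finite_verts: "finite (verts G)"
  using G by (simp add: finite_simple_graph_def)

lemma induced_verts: "induced G (verts G) = G"
  using G by (auto simp: induced_def finite_simple_graph_def nsets_def prod_eq_iff)

lemma cliques_induced: "cliques (induced G X) = {K. K \<subseteq> X \<and> clq K}"
  by (auto simp: cliques_def induced_def clique_def clq_def)

lemma clique_number_induced: "clique_number (induced G X) = om X"
  by (simp add: clique_number_def cliques_induced om_def wom_def)

lemma max_clique_weight_induced: "max_clique_weight w (induced G X) = wom w X"
  by (simp add: max_clique_weight_def cliques_induced wom_def)

lemma proper_coloring_induced: "proper_coloring (induced G X) n c \<longleftrightarrow> coloring X n c"
  by (auto simp: proper_coloring_def coloring_def induced_def)

lemma chromatic_number_induced:
  assumes "finite X" "colorable X (om X)"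
  shows "chromatic_number (induced G X) = om X"
  unfolding chromatic_number_def
proof (rule Least_equality)
  show "\<exists>c. proper_coloring (induced G X) (om X) c"
    using assms(2) by (simp add: proper_coloring_induced colorable_def)
  fix n assume "\<exists>c. proper_coloring (induced G X) n c"
  then obtain c where c: "coloring X n c" by (auto simp: proper_coloring_induced)
  obtain K where K: "K \<subseteq> X" "clq K" "card K = om X" using om_attained[OF assms(1)] by blast
  have "card (c ` K) \<le> card {..<n}"
    using c K(1) by (intro card_mono) (auto simp: coloring_def)
  then show "om X \<le> n" using coloring_clq_inj[OF c K(1,2)] K(3) by (simp add: card_image)
qed

lemma perfect_induced:
  assumes "finite X" "perf X"
  shows "perfect (induced G X)"
  unfolding perfect_def
proof (intro allI impI)
  fix Y assume "Y \<subseteq> verts (induced G X)"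
  then have Y: "Y \<subseteq> X" by (simp add: induced_def)
  then have "induced (induced G X) Y = induced G Y" by (auto simp: induced_def)
  then show "chromatic_number (induced (induced G X) Y) = clique_number (induced (induced G X) Y)"
    using chromatic_number_induced[of Y] assms Y finite_subset
    by (auto simp: clique_number_induced perf_def)
qed

text \<open>An induced copy is found as an embedding \<open>g\<close> of \<open>H\<close>, while
  \<open>isomorphic\<close> asks for a map out of the copy, hence the inverse of
  \<open>g\<close>.\<close>

lemma not_free_of:
  assumes g: "inj_on g (verts H)" "g ` verts H \<subseteq> verts G"
    and edges: "\<And>i j. i \<in> verts H \<Longrightarrow> j \<in> verts H \<Longrightarrow>
      {i, j} \<in> edges H \<longleftrightarrow> {g i, g j} \<in> edges G"
  shows "isomorphic (induced G (g ` verts H)) H" "\<not> free_of H G"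
proof -
  show iso: "isomorphic (induced G (g ` verts H)) H"
    unfolding isomorphic_def
  proof (intro exI[of _ "inv_into (verts H) g"] conjI ballI)
    show "bij_betw (inv_into (verts H) g) (verts (induced G (g ` verts H))) (verts H)"
      using g(1) by (simp add: induced_def bij_betw_inv_into inj_on_imp_bij_betw)
    fix u v assume "u \<in> verts (induced G (g ` verts H))" "v \<in> verts (induced G (g ` verts H))"
    then obtain i j where ij: "i \<in> verts H" "j \<in> verts H" "u = g i" "v = g j"
      by (auto simp: induced_def)
    then show "{u, v} \<in> edges (induced G (g ` verts H)) \<longleftrightarrow>
        {inv_into (verts H) g u, inv_into (verts H) g v} \<in> edges H"
      using edges[OF ij(1,2)] g(1) by (simp add: induced_def inv_into_f_f)
  qed
  then show "\<not> free_of H G" using g(2) by (auto simp: free_of_def)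
qed

lemma bull_free_verts:
  assumes "free_of bull G"
  shows "bull_free (verts G)"
  unfolding bull_free_def
proof (rule notI, elim bexE)
  fix a b c d e
  assume V: "a \<in> verts G" "b \<in> verts G" "c \<in> verts G" "d \<in> verts G" "e \<in> verts G"
    and adj: "{a, b} \<in> edges G \<and> {b, c} \<in> edges G \<and> {a, c} \<in> edges G \<and> {a, d} \<in> edges G \<and>
      {b, e} \<in> edges G \<and> {d, b} \<notin> edges G \<and> {d, c} \<notin> edges G \<and> {d, e} \<notin> edges G \<and>
      {e, a} \<notin> edges G \<and> {e, c} \<notin> edges G"
  define g where "g i = [a, b, c, d, e] ! i" for i
  have g: "g 0 = a" "g (Suc 0) = b" "g 2 = c" "g 3 = d" "g 4 = e" by (auto simp: g_def)
  \<comment> \<open>All 25 ordered pairs are decided, \<open>{a}\<close> being the pair of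
    \<open>a\<close> with itself; the five rows differ, which makes the vertices distinct.\<close>
  have E:
    "{a} \<notin> edges G" "{a, b} \<in> edges G" "{a, c} \<in> edges G" "{a, d} \<in> edges G" "{a, e} \<notin> edges G"
    "{b, a} \<in> edges G" "{b} \<notin> edges G" "{b, c} \<in> edges G" "{b, d} \<notin> edges G" "{b, e} \<in> edges G"
    "{c, a} \<in> edges G" "{c, b} \<in> edges G" "{c} \<notin> edges G" "{c, d} \<notin> edges G" "{c, e} \<notin> edges G"
    "{d, a} \<in> edges G" "{d, b} \<notin> edges G" "{d, c} \<notin> edges G" "{d} \<notin> edges G" "{d, e} \<notin> edges G"
    "{e, a} \<notin> edges G" "{e, b} \<in> edges G" "{e, c} \<notin> edges G" "{e, d} \<notin> edges G" "{e} \<notin> edges G"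
    using adj adj_irrefl[of a] adj_irrefl[of b] adj_irrefl[of c] adj_irrefl[of d] adj_irrefl[of e]
    by (simp_all add: insert_commute)
  then have "distinct [a, b, c, d, e]" by auto
  then have inj: "inj_on g (verts bull)" by (auto simp: bull_def g inj_on_def)
  have "{i, j} \<in> edges bull \<longleftrightarrow> {g i, g j} \<in> edges G"
    if "i \<in> verts bull" "j \<in> verts bull" for i j
  proof -
    have "i \<in> {0, 1, 2, 3, 4}" "j \<in> {0, 1, 2, 3, 4}" using that by (simp_all add: bull_def)
    then show ?thesis
      by (elim insertE emptyE) (simp_all add: bull_def g E doubleton_eq_iff)
  qed
  then have "\<not> free_of bull G"
    using not_free_of(2)[OF inj] V by (auto simp: bull_def g)
  then show False using assms by blast
qed

lemma P5_free_verts: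
  assumes "free_of (path_graph 5) G"
  shows "P5_free (verts G)"
  unfolding P5_free_def
proof (rule notI, elim bexE)
  fix p q r s t
  assume V: "p \<in> verts G" "q \<in> verts G" "r \<in> verts G" "s \<in> verts G" "t \<in> verts G"
    and adj: "{p, q} \<in> edges G \<and> {q, r} \<in> edges G \<and> {r, s} \<in> edges G \<and> {s, t} \<in> edges G \<and>
      {p, r} \<notin> edges G \<and> {p, s} \<notin> edges G \<and> {p, t} \<notin> edges G \<and> {q, s} \<notin> edges G \<and>
      {q, t} \<notin> edges G \<and> {r, t} \<notin> edges G"
  define g where "g i = [p, q, r, s, t] ! i" for i
  have g: "g 0 = p" "g (Suc 0) = q" "g 2 = r" "g 3 = s" "g 4 = t" by (auto simp: g_def)
  have verts: "verts (path_graph 5) = {0, 1, 2, 3, 4}" by (auto simp: path_graph_def)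
  have edges: "edges (path_graph 5) = {{0, 1}, {1, 2}, {2, 3}, {3, 4}}"
  proof -
    have *: "{i. Suc i < 5} = {0, 1, 2, 3}" by auto
    have "edges (path_graph 5) = (\<lambda>i. {i, Suc i}) ` {i. Suc i < 5}"
      by (auto simp: path_graph_def)
    also have "\<dots> = {{0, 1}, {1, 2}, {2, 3}, {3, 4}}" unfolding * by (simp add: eval_nat_numeral)
    finally show ?thesis .
  qed
  have E:
    "{p} \<notin> edges G" "{p, q} \<in> edges G" "{p, r} \<notin> edges G" "{p, s} \<notin> edges G" "{p, t} \<notin> edges G"
    "{q, p} \<in> edges G" "{q} \<notin> edges G" "{q, r} \<in> edges G" "{q, s} \<notin> edges G" "{q, t} \<notin> edges G"
    "{r, p} \<notin> edges G" "{r, q} \<in> edges G" "{r} \<notin> edges G" "{r, s} \<in> edges G" "{r, t} \<notin> edges G"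
    "{s, p} \<notin> edges G" "{s, q} \<notin> edges G" "{s, r} \<in> edges G" "{s} \<notin> edges G" "{s, t} \<in> edges G"
    "{t, p} \<notin> edges G" "{t, q} \<notin> edges G" "{t, r} \<notin> edges G" "{t, s} \<in> edges G" "{t} \<notin> edges G"
    using adj adj_irrefl[of p] adj_irrefl[of q] adj_irrefl[of r] adj_irrefl[of s] adj_irrefl[of t]
    by (simp_all add: insert_commute)
  then have "distinct [p, q, r, s, t]" by auto
  then have inj: "inj_on g (verts (path_graph 5))" by (auto simp: verts g inj_on_def)
  have "{i, j} \<in> edges (path_graph 5) \<longleftrightarrow> {g i, g j} \<in> edges G"
    if "i \<in> verts (path_graph 5)" "j \<in> verts (path_graph 5)" for i j
    using that unfolding verts edges
    by (elim insertE emptyE) (simp_all add: g E doubleton_eq_iff)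
  then have "\<not> free_of (path_graph 5) G"
    using not_free_of(2)[OF inj] V by (auto simp: verts g)
  then show False using assms by blast
qed

lemma no_odd_hole_verts:
  assumes "odd_hole_free G"
  shows "no_odd_hole (verts G)"
  unfolding no_odd_hole_def
proof (rule notI, elim exE conjE)
  fix k p
  assume k: "odd k" "5 \<le> k" and inj: "inj_on p {..<k}" and V: "p ` {..<k} \<subseteq> verts G"
    and adj: "\<forall>i<k. \<forall>j<k. {p i, p j} \<in> edges G \<longleftrightarrow> j = Suc i mod k \<or> i = Suc j mod k"
  have verts: "verts (cycle_graph k) = {..<k}" by (simp add: cycle_graph_def)
  have "{i, j} \<in> edges (cycle_graph k) \<longleftrightarrow> {p i, p j} \<in> edges G"
    if "i < k" "j < k" for i j
    using that adj by (auto simp: cycle_graph_def doubleton_eq_iff)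
  then have "isomorphic (induced G (p ` {..<k})) (cycle_graph k)"
    using not_free_of(1)[of p "cycle_graph k"] inj V by (simp add: verts)
  then have "hole G k (p ` {..<k})" using V k by (simp add: hole_def)
  then show False using assms k by (auto simp: odd_hole_free_def)
qed

end

theorem theorem3p7:
  fixes G :: "'a sgraph"
  assumes "finite_simple_graph G"
    and "free_of bull G"
    and "odd_hole_free G \<or> free_of (path_graph 5) G"
  shows "perfectly_weight_divisible G \<and> perfectly_divisible G"
proof -
  interpret finite_graph G by unfold_locales (rule assms(1))
  \<comment> \<open>Proved for every induced subgraph at once, as the hypotheses are hereditary;
    perfect divisibility is then the case of unit weights.\<close>
  have div: "\<exists>P W. bipartition_of X P W \<and> perfect (induced G P) \<and>
      max_clique_weight w (induced G W) < max_clique_weight w (induced G X)"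
    if X: "X \<subseteq> verts G" and w: "\<exists>v\<in>X. w v \<noteq> 0" for X w
  proof -
    have fin: "finite X" using X finite_verts finite_subset by blast
    have "bull_free X" using bull_free_subset[OF bull_free_verts[OF assms(2)] X] .
    moreover have "no_odd_hole X \<or> P5_free X"
      using assms(3) no_odd_hole_subset[OF no_odd_hole_verts X] P5_free_subset[OF P5_free_verts X]
      by blast
    ultimately obtain P W where PW: "divides_weight w X P W" using weight_division[OF fin] w by blast
    then have "finite P" using fin by (auto simp: divides_weight_def)
    then show ?thesis
      using PW perfect_induced[of P]
      by (auto simp: divides_weight_def bipartition_of_def max_clique_weight_induced)
  qed
  have "perfectly_weight_divisible G"
    unfolding perfectly_weight_divisible_def using div[of "verts G"] by (simp add: induced_verts)
  moreover have "perfectly_divisible G"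
    unfolding perfectly_divisible_def Let_def
  proof (intro allI impI)
    fix X assume X: "X \<subseteq> verts G" "X \<noteq> {}"
    obtain A B where AB: "bipartition_of X A B" "perfect (induced G A)" "om B < om X"
      using div[of X "\<lambda>_. 1"] X by (auto simp: max_clique_weight_induced om_def)
    then have "A \<subseteq> X" "B \<subseteq> X" by (auto simp: bipartition_of_def)
    then have "induced (induced G X) A = induced G A" "induced (induced G X) B = induced G B"
      by (auto simp: induced_def)
    moreover have "verts (induced G X) = X" by (simp add: induced_def)
    ultimately show "\<exists>A B. bipartition_of (verts (induced G X)) A B \<and>
        perfect (induced (induced G X) A) \<and>
        clique_number (induced (induced G X) B) < clique_number (induced G X)"
      using AB by (intro exI[of _ A] exI[of _ B]) (simp add: clique_number_induced)
  qed
  ultimately show ?thesis ..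
qed

end
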